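(* Let $\theta_0,\ldots,\theta_{m-1}$ ($m\ge3$) be a unimodular partition of the unit circle $S^1$ with associated billiard map $\widetilde B$ on $\mathcal{S}=(S^1\times S^1)\setminus(\text{diagonal})$, factor map $B:S^1\to S^1$, and set $\mathcal{S}_B\subset\mathcal{S}$. The following facts hold. (i) The restriction of $\widetilde B$ to $\mathcal{S}_B$ is a bijection on $\mathcal{S}_B$. (ii) If $(\sigma,\rho)\in\mathcal{S}$ is such that both $\sigma$ and $\rho$ are $B$-nonterminating, then $\widetilde B^t(\sigma,\rho)\in\mathcal{S}_B$ for some $t\ge0$. (iii) Let $\tilde\mu$ be the $\mathrm{PSU}^\pm_{1,1}\mathbb{C}$-invariant measure on $\mathcal{S}$ which is the image of the measure $(\omega-\alpha)^{-2}\,d\omega\,d\alpha$ on $(\mathbb{P}^1\mathbb{R}\times\mathbb{P}^1\mathbb{R})\setminus(\text{diagonal})$ under $(\omega,\alpha)\mapsto(C*\omega,C*\alpha)$. Then $(\mathcal{S}_B,\tilde\mu,\widetilde B)$ is a measure-preserving system, and so is its factor $(S^1,\mu,B)$, where $\mu=\pi_*\tilde\mu$ is the pushforward measure induced by the projection $\pi(\sigma,\rho)=\sigma$. (iv) The invertible system $(\mathcal{S}_B,\tilde\mu,\widetilde B)$ is the natural extension of $(S^1,\mu,B)$.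
   Context: $S^1=\{z\in\mathbb{C}:|z|=1\}$ is the boundary of the Poincar\'e disk $\mathcal{D}$. A pythagorean triple is $\mathbf{t}=(t_1,t_2,t_3)\in\mathbb{Z}^3$ with $t_3>0$, $\gcd(t_1,t_2,t_3)=1$, $t_1^2+t_2^2=t_3^2$; it is identified with the point $\theta=(t_1+t_2i)/t_3\in S^1\cap\mathbb{Q}(i)$. Let $L=\mathrm{diag}(1,1,-1)$ and $\langle \mathbf{x},\mathbf{y}\rangle=\mathbf{x}^\top L\mathbf{y}$. For distinct pythagorean triples $\mathbf{t},\mathbf{t}'$, the closed arc $[\mathbf{t},\mathbf{t}']$ going counterclockwise from $\mathbf{t}$ to $\mathbf{t}'$ is unimodular if $\mathbf{w}=(L\mathbf{t}'\times L\mathbf{t})/\langle\mathbf{t}',\mathbf{t}\rangle\in\mathbb{Z}^3$. A unimodular partition of $S^1$ is a counterclockwise cyclically ordered $m$-tuple $\mathbf{t}_0,\ldots,\mathbf{t}_{m-1}$ of pythagorean triples, $m\ge3$, such that each arc $[\mathbf{t}_a,\mathbf{t}_{a+1}]$ is unimodular (indices modulo $m$); $\theta_a\in S^1$ is the point identified with $\mathbf{t}_a$. Let $I_a=[\theta_a,\theta_{a+1})$ be the half-open counterclockwise arc, and let $\mathscr{A}_a$ be the hyperbolic reflection of $\mathcal{D}$ in the geodesic with ideal endpoints $\theta_a,\theta_{a+1}$, acting on $S^1$ by $\mathscr{A}_a*z=\frac{(\theta_a+\theta_{a+1})z-2\theta_a\theta_{a+1}}{2z-(\theta_a+\theta_{a+1})}$.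 The billiard map $\widetilde B:\mathcal{S}\to\mathcal{S}$ is $\widetilde B(\sigma,\rho)=(\mathscr{A}_a*\sigma,\mathscr{A}_a*\rho)$, where $a$ is the unique index with $\sigma\in I_a$; the factor map is $B(\sigma)=\mathscr{A}_a*\sigma$ for $\sigma\in I_a$. A point $\sigma$ is $B$-terminating if $B^h(\sigma)=\theta_a$ for some $h\ge0$ and some $a$; otherwise it is $B$-nonterminating. $\mathcal{S}_B$ is the set of pairs $(\sigma,\rho)\in\mathcal{S}$ such that both $\sigma$ and $\rho$ are $B$-nonterminating, and $\sigma,\rho$ belong to different intervals among $I_0,\ldots,I_{m-1}$. $C*z=(z-i)/(-iz+1)$ maps $\mathbb{P}^1\mathbb{R}$ to $S^1$. $\mathrm{PSU}^\pm_{1,1}\mathbb{C}$ is the group of matrices $\begin{pmatrix}\alpha&\beta\\ \bar\beta&\bar\alpha\end{pmatrix}$ with $\bigl||\alpha|^2-|\beta|^2\bigr|=1$, modulo $\pm I$, acting on $S^1$ by $z\mapsto(\alpha z+\beta)/(\bar\beta z+\bar\alpha)$ and diagonally on $\mathcal{S}$. In (iii) and (iv), $\tilde\mu$ is restricted to $\mathcal{S}_B$, and $\pi$ is considered on $\mathcal{S}_B$. Natural extension is in the sense of Rohlin: the invertible measure-preserving system $(\mathcal{S}_B,\tilde\mu,\widetilde B)$, having $(S^1,\mu,B)$ as a factor via $\pi$, is its natural extension if the supremum of the measurable partitions $\{\widetilde B^t(\text{fibers of }\pi)\}$, $t\ge0$, is, modulo nullsets, the partition of $\mathcal{S}_B$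 in singletons. *)

theory Defs
  imports "HOL-Analysis.Analysis"
begin

section \<open>Pythagorean triples and unimodular partitions of the circle\<close>

definition pythagorean :: "int^3 \<Rightarrow> bool" where
  "pythagorean t \<longleftrightarrow> t$3 > 0 \<and> gcd (t$1) (gcd (t$2) (t$3)) = 1 \<and> (t$1)^2 + (t$2)^2 = (t$3)^2"

definition pyth_point :: "int^3 \<Rightarrow> complex" where
  "pyth_point t = (of_int (t$1) + of_int (t$2) * \<i>) / of_int (t$3)"

definition real_vec :: "int^3 \<Rightarrow> real^3" where
  "real_vec t = (\<chi> i. real_of_int (t$i))"

definition lorentz_mat :: "real^3^3" where
  "lorentz_mat = (\<chi> i j. if i = j then (if i = 3 then -1 else 1) else 0)"

definition lorentz_form :: "real^3 \<Rightarrow> real^3 \<Rightarrow> real" where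
  "lorentz_form x y = x \<bullet> (lorentz_mat *v y)"

definition arc_normal :: "int^3 \<Rightarrow> int^3 \<Rightarrow> real^3" where
  "arc_normal t t' =
     (1 / lorentz_form (real_vec t') (real_vec t)) *\<^sub>R
       cross3 (lorentz_mat *v real_vec t') (lorentz_mat *v real_vec t)"

definition unimodular_arc :: "int^3 \<Rightarrow> int^3 \<Rightarrow> bool" where
  "unimodular_arc t t' \<longleftrightarrow>
     pythagorean t \<and> pythagorean t' \<and> t \<noteq> t' \<and> (\<forall>i. arc_normal t t' $ i \<in> \<int>)"

text \<open>An \<open>m\<close>-tuple is a list of length \<open>m\<close>. It is in counterclockwise cyclic order iff the
  angles measured counterclockwise from its first point, taken in \<open>[0, 2\<pi>)\<close>, strictly increase.\<close>

definition ccw_ordered :: "complex list \<Rightarrow> bool" where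
  "ccw_ordered zs \<longleftrightarrow>
     (\<forall>a b. a < b \<and> b < length zs \<longrightarrow> Arg2pi (zs!a / zs!0) < Arg2pi (zs!b / zs!0))"

definition unimodular_partition :: "(int^3) list \<Rightarrow> bool" where
  "unimodular_partition ts \<longleftrightarrow>
     length ts \<ge> 3 \<and> (\<forall>t\<in>set ts. pythagorean t) \<and> ccw_ordered (map pyth_point ts) \<and>
     (\<forall>a<length ts. unimodular_arc (ts!a) (ts!(Suc a mod length ts)))"


section \<open>The billiard map and its factor\<close>

abbreviation circle :: "complex set" where
  "circle \<equiv> sphere 0 1"

definition phase_space :: "(complex \<times> complex) set" where
  "phase_space = {(\<sigma>, \<rho>). \<sigma> \<in> circle \<and> \<rho> \<in> circle \<and> \<sigma> \<noteq> \<rho>}"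

text \<open>The arc \<open>[z, z')\<close>, traversed counterclockwise, for distinct points of the circle.\<close>

definition ccw_arc :: "complex \<Rightarrow> complex \<Rightarrow> complex set" where
  "ccw_arc z z' = {w \<in> circle. Arg2pi (w / z) < Arg2pi (z' / z)}"

definition vertex :: "(int^3) list \<Rightarrow> nat \<Rightarrow> complex" where
  "vertex ts a = pyth_point (ts ! (a mod length ts))"

definition side_arc :: "(int^3) list \<Rightarrow> nat \<Rightarrow> complex set" where
  "side_arc ts a = ccw_arc (vertex ts a) (vertex ts (Suc a))"

text \<open>Boundary action of the hyperbolic reflection in the geodesic with ideal endpoints
  \<open>p\<close>, \<open>q\<close>. The denominator does not vanish on the circle when \<open>p \<noteq> q\<close>.\<close>

definition reflect :: "complex \<Rightarrow> complex \<Rightarrow> complex \<Rightarrow> complex" where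
  "reflect p q z = ((p + q) * z - 2 * p * q) / (2 * z - (p + q))"

definition side_reflect :: "(int^3) list \<Rightarrow> nat \<Rightarrow> complex \<Rightarrow> complex" where
  "side_reflect ts a = reflect (vertex ts a) (vertex ts (Suc a))"

definition side_index :: "(int^3) list \<Rightarrow> complex \<Rightarrow> nat" where
  "side_index ts \<sigma> = (THE a. a < length ts \<and> \<sigma> \<in> side_arc ts a)"

definition billiard :: "(int^3) list \<Rightarrow> complex \<times> complex \<Rightarrow> complex \<times> complex" where
  "billiard ts = (\<lambda>(\<sigma>, \<rho>).
     (side_reflect ts (side_index ts \<sigma>) \<sigma>, side_reflect ts (side_index ts \<sigma>) \<rho>))"

definition billiard_factor :: "(int^3) list \<Rightarrow> complex \<Rightarrow> complex" where
  "billiard_factor ts \<sigma> = side_reflect ts (side_index ts \<sigma>) \<sigma>"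

definition terminating :: "(int^3) list \<Rightarrow> complex \<Rightarrow> bool" where
  "terminating ts \<sigma> \<longleftrightarrow> (\<exists>h. \<exists>a<length ts. (billiard_factor ts ^^ h) \<sigma> = vertex ts a)"

definition billiard_domain :: "(int^3) list \<Rightarrow> (complex \<times> complex) set" where
  "billiard_domain ts = {(\<sigma>, \<rho>) \<in> phase_space.
     \<not> terminating ts \<sigma> \<and> \<not> terminating ts \<rho> \<and>
     \<not> (\<exists>a<length ts. \<sigma> \<in> side_arc ts a \<and> \<rho> \<in> side_arc ts a)}"


section \<open>The invariant measures\<close>

definition cayley :: "real \<Rightarrow> complex" where
  "cayley \<omega> = (of_real \<omega> - \<i>) / (- \<i> * of_real \<omega> + 1)"

text \<open>The pairs in the square of the real projective line having a coordinate at infinity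
  are a null set for \<open>d\<omega> d\<alpha>\<close>, so the measure lives on the real plane minus its diagonal.\<close>

definition geodesic_measure :: "(complex \<times> complex) measure" where
  "geodesic_measure =
     distr
       (density (restrict_space lborel {(\<omega>, \<alpha>). \<omega> \<noteq> \<alpha>})
          (\<lambda>(\<omega>, \<alpha>). ennreal (1 / (\<omega> - \<alpha>)^2)))
       (restrict_space borel phase_space)
       (\<lambda>(\<omega>, \<alpha>). (cayley \<omega>, cayley \<alpha>))"

definition billiard_measure :: "(int^3) list \<Rightarrow> (complex \<times> complex) measure" where
  "billiard_measure ts = restrict_space geodesic_measure (billiard_domain ts)"

definition factor_measure :: "(int^3) list \<Rightarrow> complex measure" where
  "factor_measure ts = distr (billiard_measure ts) (restrict_space borel circle) fst"

text \<open>The condition and the action below do not change when \<open>(\<alpha>, \<beta>)\<close> is replaced by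
  \<open>(-\<alpha>, -\<beta>)\<close>, so pairs \<open>(\<alpha>, \<beta>)\<close>, standing for matrices with rows \<open>(\<alpha>, \<beta>)\<close> and
  \<open>(cnj \<beta>, cnj \<alpha>)\<close>, represent the elements of \<open>PSU\<close>.\<close>

definition SU11_pm :: "(complex \<times> complex) set" where
  "SU11_pm = {(\<alpha>, \<beta>). \<bar>(cmod \<alpha>)^2 - (cmod \<beta>)^2\<bar> = 1}"

definition SU11_act :: "complex \<times> complex \<Rightarrow> complex \<Rightarrow> complex" where
  "SU11_act = (\<lambda>(\<alpha>, \<beta>) z. (\<alpha> * z + \<beta>) / (cnj \<beta> * z + cnj \<alpha>))"


section \<open>Measure-preserving systems and natural extensions\<close>

definition measure_preserving :: "'a measure \<Rightarrow> ('a \<Rightarrow> 'a) \<Rightarrow> bool" where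
  "measure_preserving M T \<longleftrightarrow> T \<in> measurable M M \<and> distr M M T = M"

definition invertible_system :: "'a measure \<Rightarrow> ('a \<Rightarrow> 'a) \<Rightarrow> bool" where
  "invertible_system M T \<longleftrightarrow>
     measure_preserving M T \<and> bij_betw T (space M) (space M) \<and>
     the_inv_into (space M) T \<in> measurable M M"

definition factor_via ::
  "'a measure \<Rightarrow> ('a \<Rightarrow> 'a) \<Rightarrow> 'b measure \<Rightarrow> ('b \<Rightarrow> 'b) \<Rightarrow> ('a \<Rightarrow> 'b) \<Rightarrow> bool" where
  "factor_via M T N S p \<longleftrightarrow>
     p \<in> measurable M N \<and> distr M N p = N \<and> (\<forall>x\<in>space M. p (T x) = S (p x))"

text \<open>Rohlin's notion: countably many measurable unions of blocks separate any two blocks.\<close>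

definition measurable_partition :: "'a measure \<Rightarrow> 'a set set \<Rightarrow> bool" where
  "measurable_partition M P \<longleftrightarrow>
     partition_on (space M) P \<and>
     (\<exists>A::nat \<Rightarrow> 'a set.
        (\<forall>n. A n \<in> sets M \<and> (\<exists>Q\<subseteq>P. A n = \<Union>Q)) \<and>
        (\<forall>X\<in>P. \<forall>Y\<in>P. X \<noteq> Y \<longrightarrow>
           (\<exists>n. X \<subseteq> A n \<and> Y \<inter> A n = {} \<or> Y \<subseteq> A n \<and> X \<inter> A n = {})))"

text \<open>For a countable family of measurable partitions the supremum is the common refinement.\<close>

definition partition_sup :: "(nat \<Rightarrow> 'a set set) \<Rightarrow> 'a set set" where
  "partition_sup P = {\<Inter>t. X t |X. \<forall>t. X t \<in> P t} - {{}}"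

definition partition_eq_mod_null :: "'a measure \<Rightarrow> 'a set set \<Rightarrow> 'a set set \<Rightarrow> bool" where
  "partition_eq_mod_null M P Q \<longleftrightarrow>
     (\<exists>N\<in>null_sets M. (\<lambda>X. X - N) ` P - {{}} = (\<lambda>X. X - N) ` Q - {{}})"

definition fibers :: "'a set \<Rightarrow> ('a \<Rightarrow> 'b) \<Rightarrow> 'a set set" where
  "fibers A p = (\<lambda>y. {x \<in> A. p x = y}) ` p ` A"

definition image_fibers :: "'a measure \<Rightarrow> ('a \<Rightarrow> 'a) \<Rightarrow> ('a \<Rightarrow> 'b) \<Rightarrow> nat \<Rightarrow> 'a set set" where
  "image_fibers M T p t = (\<lambda>X. (T ^^ t) ` X) ` fibers (space M) p"

definition natural_extension ::
  "'a measure \<Rightarrow> ('a \<Rightarrow> 'a) \<Rightarrow> 'b measure \<Rightarrow> ('b \<Rightarrow> 'b) \<Rightarrow> ('a \<Rightarrow> 'b) \<Rightarrow> bool" where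
  "natural_extension M T N S p \<longleftrightarrow>
     invertible_system M T \<and> measure_preserving N S \<and> factor_via M T N S p \<and>
     (\<forall>t. measurable_partition M (image_fibers M T p t)) \<and>
     partition_eq_mod_null M (partition_sup (image_fibers M T p)) ((\<lambda>x. {x}) ` space M)"

end

theory Submission
  imports Defs
begin

text \<open>
  A point \<open>z\<close> of the circle is the null vector \<open>(z, 1)\<close> of a Lorentz space, an arc is a half-space
  \<open>{x. \<langle>x, w\<rangle> > 0}\<close> with \<open>\<langle>w, w\<rangle> = 1\<close>, and the reflection in the corresponding geodesic is
  \<open>x \<mapsto> x - 2\<langle>x, w\<rangle>w\<close>. The billiard map is invertible on its domain because exchanging the two
  coordinates conjugates it with its inverse.

  The heart of the matter is that two nonterminating points with the same itinerary under the factor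
  map coincide. The arcs of points sharing the first \<open>t\<close> symbols are nested, and unimodularity makes
  their normals \<open>u t\<close> integer vectors. Nesting forces the last coordinate of \<open>u t\<close> to increase
  strictly, so it tends to infinity; but an arc containing two points at distance \<open>\<delta>\<close> has a normal
  with last coordinate at most \<open>2 / \<delta>\<close>. Consequently every orbit of distinct points gets separated,
  and the past of the first coordinate determines a point of the domain, since the itinerary of
  the second coordinate can be read off it.

  The geodesic measure is invariant because the action on the circle is conjugate, via the Cayley
  map, to real Moebius maps of determinant \<open>\<plusminus>1\<close>, and \<open>(\<omega> - \<alpha>)\<^sup>-\<^sup>2 d\<omega> d\<alpha>\<close> is invariant under those. Each
  branch of the billiard map acts by an element of that group.
\<close>

section \<open>Lorentz geometry of arcs and reflections\<close>


definition lorentz :: "complex \<times> real \<Rightarrow> complex \<times> real \<Rightarrow> real" where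
  "lorentz x y = fst x \<bullet> fst y - snd x * snd y"

definition lorentz_reflect :: "complex \<times> real \<Rightarrow> complex \<times> real \<Rightarrow> complex \<times> real" where
  "lorentz_reflect w x = x - (2 * lorentz x w) *\<^sub>R w"

text \<open>For distinct \<open>p\<close>, \<open>q\<close> on the circle: the unit spacelike vector
  orthogonal to \<open>(p, 1)\<close> and \<open>(q, 1)\<close>, with the sign that makes it
  positive on the open counterclockwise arc from \<open>p\<close> to \<open>q\<close>. All
  denominators are real, so the last coordinate is real by construction.\<close>

definition normal :: "complex \<Rightarrow> complex \<Rightarrow> complex \<times> real" where
  "normal p q = (2 * \<i> * (p - q) / of_real ((cmod (p - q))\<^sup>2), Im ((p + q) * cnj (p - q)) / (cmod (p - q))\<^sup>2)"

lemma bilinear_lorentz: "bilinear lorentz"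
  by (auto simp: bilinear_def lorentz_def linear_iff inner_add_left inner_add_right algebra_simps)

lemmas lorentz_add_left = bilinear_ladd[OF bilinear_lorentz]
  and lorentz_add_right = bilinear_radd[OF bilinear_lorentz]
  and lorentz_diff_left = bilinear_lsub[OF bilinear_lorentz]
  and lorentz_diff_right = bilinear_rsub[OF bilinear_lorentz]
  and lorentz_scale_left = bilinear_lmul[OF bilinear_lorentz]
  and lorentz_scale_right = bilinear_rmul[OF bilinear_lorentz]

lemma lorentz_commute: "lorentz x y = lorentz y x"
  by (simp add: lorentz_def inner_commute mult.commute)

lemma lorentz_reflect_lorentz:
  assumes "lorentz w w = 1"
  shows "lorentz (lorentz_reflect w x) (lorentz_reflect w y) = lorentz x y"
  using assms
  by (simp add: lorentz_reflect_def lorentz_diff_left lorentz_diff_right lorentz_scale_left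
      lorentz_scale_right lorentz_commute[of w y] algebra_simps)

lemma lorentz_reflect_involution:
  assumes "lorentz w w = 1"
  shows "lorentz_reflect w (lorentz_reflect w x) = x"
  using assms
  by (simp add: lorentz_reflect_def lorentz_diff_left lorentz_scale_left algebra_simps)

lemma lorentz_reflect_normal:
  assumes "lorentz w w = 1"
  shows "lorentz (lorentz_reflect w x) w = - lorentz x w"
  using assms
  by (simp add: lorentz_reflect_def lorentz_diff_left lorentz_scale_left)

lemma lorentz_reflect_scale: "lorentz_reflect w (c *\<^sub>R x) = c *\<^sub>R lorentz_reflect w x"
  by (simp add: lorentz_reflect_def lorentz_scale_left algebra_simps)

section \<open>Normals of geodesics with endpoints on the circle\<close>

lemma cnj_circle: "z \<in> circle \<Longrightarrow> cnj z = 1 / z"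
  using complex_norm_square[of z] by (intro eq_divide_imp) (auto simp: mult.commute)

lemma cmod_diff_circle:
  assumes "p \<in> circle" "q \<in> circle"
  shows "of_real ((cmod (p - q))\<^sup>2) = - ((p - q)\<^sup>2 / (p * q))"
proof -
  have "p \<noteq> 0" "q \<noteq> 0" using assms by auto
  then show ?thesis
    unfolding complex_norm_square using assms
    by (simp add: cnj_circle field_simps power2_eq_square)
qed

text \<open>With \<open>cnj z = 1 / z\<close> on the circle, this and the next lemma turn both
  coordinates into rational functions of \<open>p\<close> and \<open>q\<close>, so that later
  identities reduce to field arithmetic.\<close>

lemma fst_normal_circle:
  assumes "p \<in> circle" "q \<in> circle" "p \<noteq> q"
  shows "fst (normal p q) = - 2 * \<i> * p * q / (p - q)"
proof -
  have "p \<noteq> 0" "q \<noteq> 0" using assms by auto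
  then show ?thesis
    unfolding normal_def fst_conv cmod_diff_circle[OF assms(1,2)] using assms(3)
    by (simp add: divide_simps) (simp add: power2_eq_square algebra_simps)
qed

lemma snd_normal_circle:
  assumes "p \<in> circle" "q \<in> circle" "p \<noteq> q"
  shows "of_real (snd (normal p q)) = - \<i> * (p + q) / (p - q)"
proof -
  have nz: "p \<noteq> 0" "q \<noteq> 0" using assms by auto
  have "2 * \<i> * of_real (Im ((p + q) * cnj (p - q))) = (p + q) * cnj (p - q) - cnj ((p + q) * cnj (p - q))"
    by (simp add: complex_eq_iff algebra_simps)
  also have "\<dots> = 2 * (q / p - p / q)"
    using assms nz by (simp add: cnj_circle field_simps)
  finally have "2 * \<i> * of_real (Im ((p + q) * cnj (p - q))) = 2 * (q / p - p / q)" .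
  then have "\<i> * of_real (Im ((p + q) * cnj (p - q))) = q / p - p / q"
    by (simp only: mult.assoc mult_cancel_left) simp
  then have "- \<i> * (\<i> * of_real (Im ((p + q) * cnj (p - q)))) = - \<i> * (q / p - p / q)"
    by (simp only:)
  then have "of_real (Im ((p + q) * cnj (p - q))) = - \<i> * (q / p - p / q)"
    unfolding mult_minus_left complex_i_mult_minus minus_minus .
  then have "of_real (snd (normal p q)) = - \<i> * (q / p - p / q) / (- ((p - q)\<^sup>2 / (p * q)))"
    unfolding normal_def snd_conv of_real_divide cmod_diff_circle[OF assms(1,2)] by (simp only:)
  also have "\<dots> = - \<i> * (p + q) / (p - q)"
    using assms(3) nz by (simp add: divide_simps) (simp add: power2_eq_square algebra_simps)
  finally show ?thesis .
qed

text \<open>The factored form shows the zeros \<open>p\<close> and \<open>q\<close>. It arises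
  because \<open>z \<bullet> \<zeta>\<close> is half of
  \<open>z * cnj \<zeta> + cnj z * \<zeta>\<close>, where both conjugates are rational on the
  circle.\<close>

lemma lorentz_null_normal:
  assumes "p \<in> circle" "q \<in> circle" "p \<noteq> q" "z \<in> circle"
  shows "of_real (lorentz (z, 1) (normal p q)) = - \<i> * (z - p) * (z - q) / (z * (p - q))"
proof -
  have nz: "p \<noteq> 0" "q \<noteq> 0" "z \<noteq> 0" using assms by auto
  define \<zeta> where "\<zeta> = fst (normal p q)"
  have \<zeta>: "\<zeta> = - 2 * \<i> * p * q / (p - q)" using fst_normal_circle assms by (simp add: \<zeta>_def)
  have c\<zeta>: "cnj \<zeta> = - 2 * \<i> / (p - q)"
    unfolding \<zeta> using assms nz by (simp add: cnj_circle divide_simps) (simp add: algebra_simps)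
  have "2 * of_real (z \<bullet> \<zeta>) = z * cnj \<zeta> + cnj z * \<zeta>"
    by (simp add: complex_eq_iff inner_complex_def)
  also have "\<dots> = z * (- 2 * \<i> / (p - q)) + (1 / z) * (- 2 * \<i> * p * q / (p - q))"
    unfolding c\<zeta> using assms(4) by (simp only: cnj_circle \<zeta>)
  also have "\<dots> = 2 * (z * (- \<i> / (p - q)) + (1 / z) * (- \<i> * p * q / (p - q)))"
    by (simp add: algebra_simps)
  finally have zz: "of_real (z \<bullet> \<zeta>) = z * (- \<i> / (p - q)) + (1 / z) * (- \<i> * p * q / (p - q))"
    by (simp only: mult_cancel_left) simp
  have "of_real (lorentz (z, 1) (normal p q)) = z * (- \<i> / (p - q)) + (1 / z) * (- \<i> * p * q / (p - q))
     - (- \<i> * (p + q) / (p - q))"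
    unfolding lorentz_def fst_conv snd_conv \<zeta>_def[symmetric] of_real_diff of_real_mult
      snd_normal_circle[OF assms(1-3)] zz by simp
  also have "\<dots> = - \<i> * (z - p) * (z - q) / (z * (p - q))"
    using nz assms(3) by (simp add: divide_simps) (simp add: algebra_simps)
  finally show ?thesis .
qed

lemma lorentz_normal_self:
  assumes "p \<in> circle" "q \<in> circle" "p \<noteq> q"
  shows "lorentz (normal p q) (normal p q) = 1"
proof -
  have nz: "p \<noteq> 0" "q \<noteq> 0" using assms by auto
  define \<zeta> where "\<zeta> = fst (normal p q)"
  have \<zeta>: "\<zeta> = - 2 * \<i> * p * q / (p - q)" using fst_normal_circle assms by (simp add: \<zeta>_def)
  have c\<zeta>: "cnj \<zeta> = - 2 * \<i> / (p - q)"
    unfolding \<zeta> using assms nz by (simp add: cnj_circle divide_simps) (simp add: algebra_simps)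
  \<comment> \<open>The imaginary unit becomes an indeterminate \<open>J\<close> with
    \<open>J\<^sup>2 = -1\<close>, which turns the goal into a polynomial identity modulo that
    relation.\<close>
  obtain J :: complex where J: "\<i> = J" "J\<^sup>2 = -1" by (metis power2_i)
  have "of_real (\<zeta> \<bullet> \<zeta>) = \<zeta> * cnj \<zeta>"
    by (simp add: dot_square_norm flip: complex_norm_square)
  then have "of_real (lorentz (normal p q) (normal p q)) = (1::complex)"
    using nz assms(3) unfolding lorentz_def \<zeta>_def[symmetric] of_real_diff of_real_mult
    unfolding snd_normal_circle[OF assms] c\<zeta>
    by (simp only: \<zeta> J) (simp add: divide_simps, use J(2) in algebra)
  then show ?thesis using of_real_eq_1_iff by blast
qed

lemma lorentz_null_normal_eq_0:
  assumes "p \<in> circle" "q \<in> circle" "p \<noteq> q" "z \<in> circle"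
  shows "lorentz (z, 1) (normal p q) = 0 \<longleftrightarrow> z = p \<or> z = q"
proof -
  have "z \<noteq> 0" using assms by auto
  have "lorentz (z, 1) (normal p q) = 0 \<longleftrightarrow> of_real (lorentz (z, 1) (normal p q)) = (0::complex)"
    by simp
  also have "\<dots> \<longleftrightarrow> z = p \<or> z = q"
    unfolding lorentz_null_normal[OF assms] using assms(3) \<open>z \<noteq> 0\<close> by simp
  finally show ?thesis .
qed

section \<open>Hyperbolic reflections as linear Lorentz reflections\<close>

lemma reflect_denominator:
  assumes "p \<in> circle" "q \<in> circle" "p \<noteq> q" "z \<in> circle"
  shows "2 * z - (p + q) \<noteq> 0"
proof
  \<comment> \<open>A zero would make \<open>z\<close> the midpoint of the chord, which lies inside
    the disk. Conjugating the equation gives a second one, and together they force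
    \<open>(p - q)\<^sup>2 = 0\<close>.\<close>
  assume "2 * z - (p + q) = 0"
  then have eq: "p + q = 2 * z" by simp
  have nz: "p \<noteq> 0" "q \<noteq> 0" "z \<noteq> 0" using assms by auto
  have "cnj p + cnj q = 2 * cnj z" using arg_cong[OF eq, of cnj] by simp
  then have "1 / p + 1 / q = 2 / z" using assms by (simp add: cnj_circle)
  then have "(p + q) * z = 2 * p * q" using nz by (simp add: field_simps)
  then have "(p - q)\<^sup>2 = 0" using eq by algebra
  with assms(3) show False by simp
qed

text \<open>Links the fractional linear formula to the linear reflection: normalizing the reflected
  null vector gives \<open>reflect p q z\<close>. Positivity of the factor matters, since signs of
  Lorentz products then carry over to points of the circle.\<close>

lemma lorentz_reflect_null:
  assumes "p \<in> circle" "q \<in> circle" "p \<noteq> q" "z \<in> circle"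
  obtains c where "c > 0" "lorentz_reflect (normal p q) (z, 1) = c *\<^sub>R (reflect p q z, 1)"
proof
  have nz: "p \<noteq> 0" "q \<noteq> 0" "z \<noteq> 0" using assms by auto
  note den = reflect_denominator[OF assms]
  \<comment> \<open>The last coordinate of the reflected vector, in a form that is visibly
    positive.\<close>
  define c where "c = (cmod (2 * z - (p + q)))\<^sup>2 / (cmod (p - q))\<^sup>2"
  show "c > 0" unfolding c_def using den assms(3) by auto
  define L where "L = lorentz (z, 1) (normal p q)"
  have L: "of_real L = - \<i> * (z - p) * (z - q) / (z * (p - q))"
    unfolding L_def by (rule lorentz_null_normal[OF assms])
  obtain J :: complex where J: "\<i> = J" "J\<^sup>2 = -1" by (metis power2_i)
  have "of_real c = (2 * z - (p + q)) * (2 / z - (1 / p + 1 / q)) / (- ((p - q)\<^sup>2 / (p * q)))"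
    unfolding c_def of_real_divide cmod_diff_circle[OF assms(1,2)]
    unfolding complex_norm_square using assms by (simp add: cnj_circle)
  also have "\<dots> = - ((2 * z - (p + q)) * (2 * p * q - (p + q) * z) / (z * (p - q)\<^sup>2))"
    using nz assms(3) by (simp add: divide_simps)
  finally have c: "of_real c = - ((2 * z - (p + q)) * (2 * p * q - (p + q) * z) / (z * (p - q)\<^sup>2))" .
  have "of_real (1 - 2 * L * snd (normal p q)) = (of_real c :: complex)"
    unfolding of_real_diff of_real_mult L c snd_normal_circle[OF assms(1-3)] J using nz assms(3)
    by (simp add: divide_simps) (use J(2) in algebra)
  then have 1: "1 - 2 * L * snd (normal p q) = c" using of_real_eq_iff by blast
  have 2: "z - of_real (2 * L) * fst (normal p q) = of_real c * reflect p q z"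
    unfolding of_real_mult L c fst_normal_circle[OF assms(1-3)] reflect_def J using nz assms(3) den
    by (simp add: divide_simps) (use J(2) in algebra)
  show "lorentz_reflect (normal p q) (z, 1) = c *\<^sub>R (reflect p q z, 1)"
    unfolding lorentz_reflect_def L_def[symmetric] using 1 2
    by (simp add: prod_eq_iff scaleR_conv_of_real)
qed

lemma lorentz_null_iff: "lorentz (z, 1) (z, 1) = 0 \<longleftrightarrow> z \<in> circle"
proof -
  have "lorentz (z, 1) (z, 1) = (cmod z)\<^sup>2 - 1" by (simp add: lorentz_def dot_square_norm)
  moreover have "cmod z \<noteq> - 1" using norm_ge_zero[of z] by linarith
  ultimately show ?thesis by (simp add: power2_eq_1_iff)
qed

lemma reflect_circle:
  assumes "p \<in> circle" "q \<in> circle" "p \<noteq> q" "z \<in> circle"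
  shows "reflect p q z \<in> circle"
proof -
  obtain c where "c > 0" and c: "lorentz_reflect (normal p q) (z, 1) = c *\<^sub>R (reflect p q z, 1)"
    using lorentz_reflect_null[OF assms] .
  have "lorentz (c *\<^sub>R (reflect p q z, 1)) (c *\<^sub>R (reflect p q z, 1)) = 0"
    unfolding c[symmetric] lorentz_reflect_lorentz[OF lorentz_normal_self[OF assms(1-3)]]
      lorentz_null_iff by (rule assms(4))
  then have "lorentz (reflect p q z, 1) (reflect p q z, 1) = 0"
    using \<open>c > 0\<close> unfolding lorentz_scale_left lorentz_scale_right by simp
  then show ?thesis by (simp only: lorentz_null_iff)
qed


lemma reflect_involution:
  assumes "p \<in> circle" "q \<in> circle" "p \<noteq> q" "z \<in> circle"
  shows "reflect p q (reflect p q z) = z"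
proof -
  obtain c where "c > 0" and c: "lorentz_reflect (normal p q) (z, 1) = c *\<^sub>R (reflect p q z, 1)"
    using lorentz_reflect_null[OF assms] .
  obtain d where "d > 0" and d: "lorentz_reflect (normal p q) (reflect p q z, 1)
    = d *\<^sub>R (reflect p q (reflect p q z), 1)"
    using lorentz_reflect_null[OF assms(1-3) reflect_circle[OF assms]] .
  have "c *\<^sub>R d *\<^sub>R (reflect p q (reflect p q z), 1) = (z, 1::real)"
    using lorentz_reflect_involution[OF lorentz_normal_self[OF assms(1-3)], of "(z, 1)"]
    unfolding c lorentz_reflect_scale d .
  \<comment> \<open>The last coordinates give \<open>c * d = 1\<close>, so the scalars drop out of
    the first ones.\<close>
  then have "(c * d) *\<^sub>R reflect p q (reflect p q z) = z \<and> c * d = 1"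
    unfolding scaleR_Pair scaleR_scaleR prod.inject real_scaleR_def mult_1_right .
  then show ?thesis by (metis scaleR_one)
qed

text \<open>The linear reflection negates the product with its normal, and normalizing by a positive
  factor keeps that change of sign.\<close>

lemma reflect_swaps_sides:
  assumes "p \<in> circle" "q \<in> circle" "p \<noteq> q" "z \<in> circle"
  shows "lorentz (reflect p q z, 1) (normal p q) < 0 \<longleftrightarrow> lorentz (z, 1) (normal p q) > 0"
    and "lorentz (reflect p q z, 1) (normal p q) > 0 \<longleftrightarrow> lorentz (z, 1) (normal p q) < 0"
proof -
  obtain c where "c > 0" and c: "lorentz_reflect (normal p q) (z, 1) = c *\<^sub>R (reflect p q z, 1)"
    using lorentz_reflect_null[OF assms] .
  have "c * lorentz (reflect p q z, 1) (normal p q) = - lorentz (z, 1) (normal p q)"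
    using lorentz_reflect_normal[OF lorentz_normal_self[OF assms(1-3)], of "(z, 1)"]
    unfolding c lorentz_scale_left by simp
  with \<open>c > 0\<close> have "lorentz (reflect p q z, 1) (normal p q) = - lorentz (z, 1) (normal p q) / c"
    by (simp add: field_simps)
  with \<open>c > 0\<close> show "lorentz (reflect p q z, 1) (normal p q) < 0 \<longleftrightarrow> lorentz (z, 1) (normal p q) > 0"
    "lorentz (reflect p q z, 1) (normal p q) > 0 \<longleftrightarrow> lorentz (z, 1) (normal p q) < 0"
    by (simp_all add: zero_less_divide_iff divide_less_0_iff)
qed

section \<open>Counterclockwise arcs as half-spaces\<close>

lemma circle_div_cis:
  assumes "p \<in> circle" "z \<in> circle"
  shows "z = p * cis (Arg2pi (z / p))"
proof -
  have "p \<noteq> 0" "cmod (z / p) = 1" using assms by (auto simp: norm_divide)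
  then have "z / p = cis (Arg2pi (z / p))"
    using Arg2pi_eq[of "z / p"] unfolding cis_conv_exp by simp
  with \<open>p \<noteq> 0\<close> show ?thesis by (simp add: divide_eq_eq mult.commute)
qed

text \<open>With angles measured from \<open>p\<close>, the product becomes a quotient of sines of
  half angles, whose signs are easy to control when the angles lie in
  \<open>[0, 2\<pi>)\<close>.\<close>

lemma lorentz_normal_cis:
  assumes "p \<in> circle" "p \<noteq> p * cis b"
  shows "lorentz (p * cis a, 1) (normal p (p * cis b))
    = 2 * sin (a / 2) * sin ((b - a) / 2) / sin (b / 2)"
proof -
  have nz: "p \<noteq> 0" using assms by auto
  \<comment> \<open>Half angles make every sine involved a Laurent polynomial in \<open>s\<close>
    and \<open>t\<close>.\<close>
  define s t where "s = cis (a / 2)" and "t = cis (b / 2)"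
  have st: "s \<noteq> 0" "t \<noteq> 0" by (auto simp: s_def t_def)
  have a: "cis a = s\<^sup>2" and b: "cis b = t\<^sup>2"
    by (simp_all add: s_def t_def Complex.DeMoivre)
  have sin_cis: "of_real (sin x) = - \<i> / 2 * (cis x - 1 / cis x)" for x
    unfolding inverse_eq_divide[symmetric] cis_inverse by (simp add: complex_eq_iff)
  have ab: "cis ((b - a) / 2) = t / s"
    by (simp add: s_def t_def cis_divide diff_divide_distrib)
  have t1: "t\<^sup>2 \<noteq> 1" using assms(2) b by auto
  have c: "p * cis b \<in> circle" "p * cis a \<in> circle" using assms by (auto simp: norm_mult)
  have "of_real (2 * sin (a / 2) * sin ((b - a) / 2) / sin (b / 2)) =
    2 * (- \<i> / 2 * (s - 1 / s)) * (- \<i> / 2 * (t / s - s / t)) / (- \<i> / 2 * (t - 1 / t))"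
    unfolding of_real_mult of_real_divide sin_cis ab by (simp add: s_def t_def)
  also have "\<dots> = - \<i> * ((s - 1 / s) * (t / s - s / t) / (t - 1 / t))"
    by simp
  also have "(s - 1 / s) * (t / s - s / t) / (t - 1 / t) =
    (p * s\<^sup>2 - p) * (p * s\<^sup>2 - p * t\<^sup>2) / (p * s\<^sup>2 * (p - p * t\<^sup>2))"
  proof -
    have "t - 1 / t = (t\<^sup>2 - 1) / t" "s - 1 / s = (s\<^sup>2 - 1) / s"
      "t / s - s / t = (t\<^sup>2 - s\<^sup>2) / (s * t)"
      using st by (simp_all add: field_simps power2_eq_square)
    moreover have "p * s\<^sup>2 - p = p * (s\<^sup>2 - 1)" "p * s\<^sup>2 - p * t\<^sup>2 = - (p * (t\<^sup>2 - s\<^sup>2))"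
      "p - p * t\<^sup>2 = - (p * (t\<^sup>2 - 1))"
      by (simp_all add: algebra_simps)
    ultimately show ?thesis using nz st t1
      by (simp add: power2_eq_square)
  qed
  also have "- \<i> * \<dots> = of_real (lorentz (p * cis a, 1) (normal p (p * cis b)))"
    unfolding lorentz_null_normal[OF assms(1) c(1) assms(2) c(2)] unfolding a b
    by (simp add: mult.assoc)
  finally have "of_real (2 * sin (a / 2) * sin ((b - a) / 2) / sin (b / 2)) =
    (of_real (lorentz (p * cis a, 1) (normal p (p * cis b))) :: complex)" .
  then show ?thesis using of_real_eq_iff by metis
qed

text \<open>Measured from \<open>p\<close>, the angles lie in \<open>[0, 2\<pi>)\<close>, so the
  sines of \<open>a / 2\<close> and \<open>b / 2\<close> are not negative and the sign of the
  product is decided by \<open>sin ((b - a) / 2)\<close>, that is, by \<open>a < b\<close>. At the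
  included endpoint \<open>p\<close> the product vanishes, hence the separate disjunct.\<close>

lemma mem_ccw_arc:
  assumes "p \<in> circle" "q \<in> circle" "p \<noteq> q"
  shows "z \<in> ccw_arc p q \<longleftrightarrow> z \<in> circle \<and> (z = p \<or> lorentz (z, 1) (normal p q) > 0)"
proof (cases "z \<in> circle")
  case True
  define a b where "a = Arg2pi (z / p)" and "b = Arg2pi (q / p)"
  have z: "z = p * cis a" and q: "q = p * cis b"
    using circle_div_cis assms True by (auto simp: a_def b_def)
  have a: "0 \<le> a" "a < 2 * pi" and b: "0 \<le> b" "b < 2 * pi"
    using Arg2pi by (auto simp: a_def b_def)
  have "b \<noteq> 0" using q assms(3) by auto
  with b have sb: "sin (b / 2) > 0" by (intro sin_gt_zero) auto
  have za: "z = p \<longleftrightarrow> a = 0"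
  proof
    assume "z = p" then show "a = 0" using assms(1) Arg2pi_of_real[of 1] by (auto simp: a_def)
  qed (use z in auto)
  have "lorentz (z, 1) (normal p q) > 0 \<longleftrightarrow> sin (a / 2) * sin ((b - a) / 2) > 0"
    using lorentz_normal_cis[of p b a] assms sb unfolding z q
    by (simp add: zero_less_divide_iff zero_less_mult_iff) 
  also have "\<dots> \<longleftrightarrow> a \<noteq> 0 \<and> a < b"
  proof (cases "a = 0")
    case False
    with a have "sin (a / 2) > 0" by (intro sin_gt_zero) auto
    moreover have "sin ((b - a) / 2) > 0 \<longleftrightarrow> a < b"
    proof
      assume "a < b" then show "sin ((b - a) / 2) > 0" using a b by (intro sin_gt_zero) auto
    next
      assume *: "sin ((b - a) / 2) > 0"
      show "a < b"
      proof (rule ccontr)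
        assume "\<not> a < b"
        then have "sin ((a - b) / 2) \<ge> 0" using a b by (intro sin_ge_zero) auto
        moreover have "sin ((a - b) / 2) = - sin ((b - a) / 2)"
          by (metis minus_diff_eq minus_divide_left sin_minus)
        ultimately show False using * by simp
      qed
    qed
    ultimately show ?thesis using False by (auto simp: zero_less_mult_iff)
  qed simp
  finally show ?thesis
    using True za b \<open>b \<noteq> 0\<close> by (auto simp: ccw_arc_def a_def[symmetric] b_def[symmetric])
qed (simp add: ccw_arc_def)


text \<open>Normals of disjoint arcs. Expanding \<open>w\<close> in the basis \<open>(p, 1)\<close>, \<open>(q, 1)\<close>, \<open>normal p q\<close> gives
  \<open>\<bar>\<langle>w, normal p q\<rangle>\<bar> \<ge> 1\<close>; the point \<open>z\<close> decides the sign.\<close>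

lemma lorentz_normal_le_minus_1:
  assumes p: "p \<in> circle" and q: "q \<in> circle" and "p \<noteq> q"
    and w: "lorentz w w = 1" and wp: "lorentz (p, 1) w \<le> 0" and wq: "lorentz (q, 1) w \<le> 0"
    and z: "z \<in> circle" "lorentz (z, 1) w > 0" "lorentz (z, 1) (normal p q) \<le> 0"
  shows "lorentz w (normal p q) \<le> -1"
proof -
  define N where "N = normal p q"
  have N: "lorentz N N = 1" "lorentz (p, 1) N = 0" "lorentz (q, 1) N = 0"
    using assms by (simp_all add: N_def lorentz_normal_self lorentz_null_normal_eq_0)
  have null: "lorentz (p, 1) (p, 1) = 0" "lorentz (q, 1) (q, 1) = 0"
    using p q by (simp_all only: lorentz_null_iff)
  have neg: "lorentz (x, 1) (y, 1) \<le> 0" if "x \<in> circle" "y \<in> circle" for x y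
    using that Cauchy_Schwarz_ineq2[of x y] by (simp add: lorentz_def)
  define g where "g = lorentz (p, 1) (q, 1)"
  have "(cmod (p - q))\<^sup>2 = - 2 * g"
    using p q dot_norm_neg[of p q] by (simp add: g_def lorentz_def)
  moreover have "(cmod (p - q))\<^sup>2 > 0" using \<open>p \<noteq> q\<close> by simp
  ultimately have "g < 0" by simp
  define k where "k = lorentz w N"
  \<comment> \<open>Pairing the desired expansion of \<open>w\<close> with \<open>(q, 1)\<close> and
    with \<open>(p, 1)\<close> leaves only the cross term \<open>g\<close>, which dictates the
    coefficients \<open>x\<close> and \<open>y\<close>.\<close>
  define x where "x = lorentz (q, 1) w / g"
  define y where "y = lorentz (p, 1) w / g"
  have xy: "x \<ge> 0" "y \<ge> 0"
    using wp wq \<open>g < 0\<close> by (simp_all add: x_def y_def divide_nonpos_neg)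
  \<comment> \<open>The remainder of the expansion is orthogonal to all three basis vectors; it
    turns out to be a multiple of \<open>N\<close> and hence zero.\<close>
  define e where "e = w - k *\<^sub>R N - x *\<^sub>R (p, 1) - y *\<^sub>R (q, 1)"
  have g': "lorentz (q, 1) (p, 1) = g" by (simp add: g_def lorentz_commute)
  have ep: "lorentz (p, 1) e = 0" "lorentz (q, 1) e = 0"
    unfolding e_def lorentz_diff_right lorentz_scale_right N null g_def[symmetric] g'
    using \<open>g < 0\<close> by (simp_all add: x_def y_def)
  have eN: "lorentz e N = 0"
    unfolding e_def lorentz_diff_left lorentz_scale_left N k_def[symmetric] by simp
  define v where "v = p - q"
  have "v \<noteq> 0" using \<open>p \<noteq> q\<close> by (simp add: v_def)
  have Ev: "fst e \<bullet> v = 0"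
    using ep by (simp add: v_def lorentz_def inner_diff inner_commute)
  \<comment> \<open>\<open>fst e\<close> is orthogonal to \<open>v = p - q\<close> in the Euclidean
    plane, so it is a multiple of \<open>\<i> * v\<close> and thus of \<open>fst N\<close>;
    \<open>\<tau>\<close> is the coefficient.\<close>
  define \<tau> where "\<tau> = (fst e \<bullet> (\<i> * v)) / 2"
  have "fst e = \<tau> *\<^sub>R fst N"
  proof -
    have nv: "(Re v)\<^sup>2 + (Im v)\<^sup>2 \<noteq> 0" using \<open>v \<noteq> 0\<close> by (simp add: complex_eq_iff)
    have "Re (fst e) * ((Re v)\<^sup>2 + (Im v)\<^sup>2) = - (fst e \<bullet> (\<i> * v)) * Im v"
      "Im (fst e) * ((Re v)\<^sup>2 + (Im v)\<^sup>2) = (fst e \<bullet> (\<i> * v)) * Re v"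
      using Ev unfolding inner_complex_def by (simp_all add: power2_eq_square) algebra+
    then show ?thesis
      using nv by (simp add: complex_eq_iff N_def normal_def v_def[symmetric] \<tau>_def cmod_power2 field_simps)
  qed
  moreover have "snd e = \<tau> * snd N"
    using ep(1) N(2) calculation by (simp add: lorentz_def)
  ultimately have "e = \<tau> *\<^sub>R N" by (simp add: prod_eq_iff)
  with eN N(1) have "\<tau> = 0" by (simp add: lorentz_scale_left)
  with \<open>e = \<tau> *\<^sub>R N\<close> have w_eq: "w = k *\<^sub>R N + x *\<^sub>R (p, 1) + y *\<^sub>R (q, 1)"
    by (simp add: e_def algebra_simps)
  have "lorentz w w = k * k + 2 * x * y * g"
    unfolding w_eq lorentz_add_left lorentz_add_right lorentz_scale_left lorentz_scale_right
      N null g_def[symmetric] g' lorentz_commute[of N "(p, 1)"] lorentz_commute[of N "(q, 1)"]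
    by (simp add: algebra_simps)
  moreover have "x * y * g \<le> 0" using xy \<open>g < 0\<close> by (simp add: mult_nonneg_nonpos)
  ultimately have "k\<^sup>2 \<ge> 1\<^sup>2" using w by (simp add: power2_eq_square)
  then have "\<bar>k\<bar> \<ge> 1" by (metis abs_le_square_iff abs_one)
  \<comment> \<open>For \<open>k \<ge> 0\<close> all three terms in the expansion of
    \<open>lorentz (z, 1) w\<close> would be nonpositive, because normalized null vectors have
    nonpositive products with each other.\<close>
  moreover have "k < 0"
  proof (rule ccontr)
    assume "\<not> k < 0"
    moreover have "lorentz (z, 1) w = k * lorentz (z, 1) N + x * lorentz (z, 1) (p, 1) + y * lorentz (z, 1) (q, 1)"
      by (subst w_eq) (simp only: lorentz_add_right lorentz_scale_right real_scaleR_def)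
    moreover have "x * lorentz (z, 1) (p, 1) \<le> 0" "y * lorentz (z, 1) (q, 1) \<le> 0"
      using xy neg p q z(1) by (simp_all add: mult_nonneg_nonpos)
    moreover have "k * lorentz (z, 1) N \<le> 0"
      using calculation(1) z(3) by (simp add: N_def mult_nonneg_nonpos)
    ultimately show False using z(2) by linarith
  qed
  ultimately show ?thesis by (simp add: k_def N_def)
qed

text \<open>Of two nested half-spaces, the normals differ by a causal vector; \<open>r\<close> shows that it points to
  the future.\<close>

lemma lorentz_nested_snd_less:
  assumes u: "lorentz u u = 1" and v: "lorentz v v = 1" and uv: "lorentz u v \<ge> 1"
    and r: "r \<in> circle" "lorentz (r, 1) u > 0" "lorentz (r, 1) v \<le> 0"
  shows "snd u < snd v"
proof (rule ccontr)
  assume "\<not> snd u < snd v"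
  define d where "d = v - u"
  have "lorentz d d \<le> 0"
    using u v uv by (simp add: d_def lorentz_diff_left lorentz_diff_right lorentz_commute[of v u])
  then have "(cmod (fst d))\<^sup>2 \<le> (snd d)\<^sup>2"
    by (simp add: lorentz_def dot_square_norm power2_eq_square)
  then have "cmod (fst d) \<le> \<bar>snd d\<bar>" by (metis abs_le_square_iff abs_norm_cancel)
  moreover have "\<bar>r \<bullet> fst d\<bar> \<le> cmod (fst d)"
    using Cauchy_Schwarz_ineq2[of r "fst d"] r(1) by simp
  moreover have "r \<bullet> fst d < snd d"
    using r(2,3) by (simp add: d_def lorentz_def inner_diff)
  ultimately show False using \<open>\<not> snd u < snd v\<close> by (simp add: d_def)
qed

text \<open>For \<open>s = snd u \<ge> 0\<close> the half-space of \<open>u\<close> cuts out an arc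
  with chord \<open>2 / sqrt (1 + s\<^sup>2)\<close>. The bound comes from adding the two positivity
  conditions, applying Cauchy-Schwarz, and expressing \<open>cmod (\<sigma> + \<rho>)\<close>
  through the distance by the parallelogram law.\<close>

lemma snd_bound_of_two_points:
  assumes "lorentz u u = 1" "\<sigma> \<in> circle" "\<rho> \<in> circle"
    and "lorentz (\<sigma>, 1) u > 0" "lorentz (\<rho>, 1) u > 0"
  shows "snd u * cmod (\<sigma> - \<rho>) \<le> 2"
proof (cases "snd u \<le> 0")
  case True
  then have "snd u * cmod (\<sigma> - \<rho>) \<le> 0" by (simp add: mult_nonpos_nonneg)
  then show ?thesis by simp
next
  case False
  define s \<delta> where "s = snd u" and "\<delta> = cmod (\<sigma> - \<rho>)"
  have U: "(cmod (fst u))\<^sup>2 = 1 + s\<^sup>2"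
    using assms(1) by (simp add: lorentz_def dot_square_norm power2_eq_square s_def)
  have par: "(cmod (\<sigma> + \<rho>))\<^sup>2 = 4 - \<delta>\<^sup>2"
    using dot_norm[of \<sigma> \<rho>] dot_norm_neg[of \<sigma> \<rho>] assms(2,3) by (simp add: \<delta>_def)
  have "2 * s \<le> (\<sigma> + \<rho>) \<bullet> fst u"
    using assms(4,5) by (simp add: lorentz_def s_def inner_add_left)
  also have "\<dots> \<le> cmod (\<sigma> + \<rho>) * cmod (fst u)" by (rule norm_cauchy_schwarz)
  finally have "(2 * s)\<^sup>2 \<le> (cmod (\<sigma> + \<rho>) * cmod (fst u))\<^sup>2"
    using False by (intro power_mono) (auto simp: s_def)
  then have "4 * s\<^sup>2 \<le> (4 - \<delta>\<^sup>2) * (1 + s\<^sup>2)" by (simp add: power_mult_distrib par U)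
  then have "(s * \<delta>)\<^sup>2 + \<delta>\<^sup>2 \<le> 2\<^sup>2" by (simp add: power_mult_distrib algebra_simps)
  then have "(s * \<delta>)\<^sup>2 \<le> 2\<^sup>2" using zero_le_power2[of \<delta>] by linarith
  then show ?thesis unfolding s_def \<delta>_def by (rule power2_le_imp_le) simp
qed

section \<open>Integrality of the normals of unimodular arcs\<close>

definition int_vec :: "complex \<times> real \<Rightarrow> bool" where
  "int_vec x \<longleftrightarrow> Re (fst x) \<in> \<int> \<and> Im (fst x) \<in> \<int> \<and> snd x \<in> \<int>"

lemma int_vec_lorentz_reflect:
  assumes "int_vec w" "int_vec x"
  shows "int_vec (lorentz_reflect w x)"
proof -
  have "lorentz x w \<in> \<int>"
    using assms by (auto simp: int_vec_def lorentz_def inner_complex_def)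
  then have "2 * lorentz x w \<in> \<int>" by (intro Ints_mult) auto
  then show ?thesis
    using assms unfolding int_vec_def lorentz_reflect_def
    by (auto intro!: Ints_mult Ints_diff)
qed

lemma pyth_point_eq:
  "pyth_point t = Complex (real_of_int (t$1) / real_of_int (t$3)) (real_of_int (t$2) / real_of_int (t$3))"
proof -
  have "(of_int n :: complex) = of_real (real_of_int n)" for n
    by simp
  then show ?thesis
    unfolding pyth_point_def by (simp add: complex_eq_iff del: of_real_of_int_eq)
qed

lemma pyth_point_circle:
  assumes "pythagorean t"
  shows "pyth_point t \<in> circle"
proof -
  have t3: "t$3 > 0" and sq: "(t$1)\<^sup>2 + (t$2)\<^sup>2 = (t$3)\<^sup>2" using assms by (auto simp: pythagorean_def)
  have "(real_of_int (t$1))\<^sup>2 + (real_of_int (t$2))\<^sup>2 = (real_of_int (t$3))\<^sup>2"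
    using arg_cong[OF sq, of real_of_int] by simp
  then show ?thesis
    using t3 by (simp add: pyth_point_eq cmod_def power_divide flip: add_divide_distrib)
qed

text \<open>The \<open>normal\<close> of the two points is the \<open>arc_normal\<close> of the two
  triples, coordinate by coordinate: the denominators match because
  \<open>(cmod (p - q))\<^sup>2 = - 2 * g / (z * z')\<close>, where \<open>g\<close> is the Lorentz
  product of the triples.\<close>

lemma int_vec_normal:
  assumes "unimodular_arc t t'" "pyth_point t \<noteq> pyth_point t'"
  shows "int_vec (normal (pyth_point t) (pyth_point t'))"
proof -
  have t: "pythagorean t" "pythagorean t'" and int: "\<And>i. arc_normal t t' $ i \<in> \<int>"
    using assms by (auto simp: unimodular_arc_def)
  define x y z where "x = real_of_int (t$1)" and "y = real_of_int (t$2)" and "z = real_of_int (t$3)"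
  define x' y' z' where "x' = real_of_int (t'$1)" and "y' = real_of_int (t'$2)" and "z' = real_of_int (t'$3)"
  have z: "z > 0" "z' > 0" using t by (auto simp: z_def z'_def pythagorean_def)
  define p q where "p = pyth_point t" and "q = pyth_point t'"
  have p: "p = Complex (x / z) (y / z)" and q: "q = Complex (x' / z') (y' / z')"
    by (simp_all add: p_def q_def x_def y_def z_def x'_def y'_def z'_def pyth_point_eq)
  have pq: "p \<in> circle" "q \<in> circle" "p \<noteq> q"
    using t assms pyth_point_circle by (auto simp: p_def q_def)
  define g where "g = x * x' + y * y' - z * z'"
  have mat: "lorentz_mat *v real_vec s = vector [of_int (s$1), of_int (s$2), - of_int (s$3)]" for s
    by (simp add: vec_eq_iff forall_3 lorentz_mat_def real_vec_def matrix_vector_mult_def sum_3)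
  have form: "lorentz_form (real_vec t') (real_vec t) = g"
    unfolding lorentz_form_def mat
    by (simp add: inner_vec_def sum_3 real_vec_def g_def x_def y_def z_def
        x'_def y'_def z'_def algebra_simps)
  have an: "arc_normal t t' $ 1 = (z' * y - y' * z) / g" "arc_normal t t' $ 2 = (x' * z - z' * x) / g"
    "arc_normal t t' $ 3 = (x' * y - y' * x) / g"
    unfolding arc_normal_def form mat
    by (simp_all add: cross3_def x_def y_def z_def x'_def y'_def z'_def diff_divide_distrib algebra_simps)
  have "(cmod (p - q))\<^sup>2 = 2 - 2 * (p \<bullet> q)"
    using pq dot_norm_neg[of p q] by simp
  also have "\<dots> = - 2 * g / (z * z')"
    using z by (simp add: p q inner_complex_def g_def field_simps)
  finally have n: "(cmod (p - q))\<^sup>2 = - 2 * g / (z * z')" .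
  then have "g \<noteq> 0" using pq by auto
  have "Re (fst (normal p q)) = arc_normal t t' $ 1"
    "Im (fst (normal p q)) = arc_normal t t' $ 2" "snd (normal p q) = arc_normal t t' $ 3"
    unfolding an normal_def n fst_conv snd_conv using z \<open>g \<noteq> 0\<close>
    by (simp_all add: p q Re_divide_of_real Im_divide_of_real field_simps del: of_real_divide of_real_mult of_real_minus)
  then show ?thesis using int by (simp add: int_vec_def p_def q_def)
qed


text \<open>Change of base point: angles from \<open>p\<close> become differences of angles from
  \<open>o'\<close>, with a full turn added when the way from \<open>p\<close> to \<open>z\<close>
  reaches \<open>o'\<close>.\<close>

lemma Arg2pi_divide_circle:
  assumes "o' \<in> circle" "p \<in> circle" "z \<in> circle"
  shows "Arg2pi (z / p) = (if Arg2pi (p / o') \<le> Arg2pi (z / o') then 0 else 2 * pi)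
    + Arg2pi (z / o') - Arg2pi (p / o')"
proof -
  define a b where "a = Arg2pi (p / o')" and "b = Arg2pi (z / o')"
  have eq: "p = o' * cis a" "z = o' * cis b"
    using circle_div_cis assms by (auto simp: a_def b_def)
  have bd: "0 \<le> a" "a < 2 * pi" "0 \<le> b" "b < 2 * pi" using Arg2pi by (auto simp: a_def b_def)
  have "o' \<noteq> 0" using assms by auto
  then have "z / p = cis (b - a)" by (simp add: eq flip: cis_divide)
  moreover have "cis (2 * pi + b - a) = cis (b - a)"
    using cis_mult[of "2 * pi" "b - a"] by (simp add: add_diff_eq)
  ultimately have "cis ((if a \<le> b then 0 else 2 * pi) + b - a) = z / p"
    by simp
  then have "of_real 1 * exp (\<i> * of_real ((if a \<le> b then 0 else 2 * pi) + b - a)) = z / p"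
    unfolding cis_conv_exp by simp
  then have "Arg2pi (z / p) = (if a \<le> b then 0 else 2 * pi) + b - a"
    by (rule Arg2pi_unique) (use bd in auto)
  then show ?thesis by (simp only: a_def b_def)
qed

section \<open>Itineraries under the factor map\<close>

locale unimodular_billiard =
  fixes ts :: "(int^3) list"
  assumes unimodular: "unimodular_partition ts"
begin

abbreviation "m \<equiv> length ts"
abbreviation "\<theta> \<equiv> vertex ts"
abbreviation "B \<equiv> billiard_factor ts"

definition side_normal :: "nat \<Rightarrow> complex \<times> real" where
  "side_normal a = normal (\<theta> a) (\<theta> (Suc a))"

lemma length_ge_3: "m \<ge> 3"
  using unimodular by (simp add: unimodular_partition_def)

lemma vertex_mod: "\<theta> (a mod m) = \<theta> a"
  by (simp add: vertex_def)

lemma vertex_circle: "\<theta> a \<in> circle"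
proof -
  have "a mod m < m" using length_ge_3 by (intro mod_less_divisor) linarith
  then have "ts ! (a mod m) \<in> set ts" by simp
  then show ?thesis
    using unimodular pyth_point_circle unfolding unimodular_partition_def vertex_def by blast
qed

lemma vertex_norm: "cmod (\<theta> a) = 1"
  using vertex_circle[of a] by simp

section \<open>The side arcs partition the circle\<close>

lemma vertex_angle_less:
  assumes "a < b" "b < m"
  shows "Arg2pi (\<theta> a / \<theta> 0) < Arg2pi (\<theta> b / \<theta> 0)"
proof -
  have "ccw_ordered (map pyth_point ts)" using unimodular by (simp add: unimodular_partition_def)
  then have "Arg2pi (map pyth_point ts ! a / map pyth_point ts ! 0)
    < Arg2pi (map pyth_point ts ! b / map pyth_point ts ! 0)"
    using assms unfolding ccw_ordered_def by simp
  moreover have "0 < m" using length_ge_3 by linarith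
  ultimately show ?thesis using assms by (simp add: vertex_def)
qed

lemma vertex_inj:
  assumes "a < m" "b < m" "\<theta> a = \<theta> b"
  shows "a = b"
  using vertex_angle_less[of a b] vertex_angle_less[of b a] assms by (metis less_irrefl nat_neq_iff)

lemma Suc_mod_cases:
  assumes "a < m"
  obtains "Suc a < m" "Suc a mod m = Suc a" | "Suc a = m" "Suc a mod m = 0"
  using assms by (metis Suc_lessI mod_less mod_self)

lemma vertex_neq_Suc:
  assumes "a < m"
  shows "\<theta> a \<noteq> \<theta> (Suc a)"
proof
  assume "\<theta> a = \<theta> (Suc a)"
  then have eq: "\<theta> a = \<theta> (Suc a mod m)" by (simp only: vertex_mod)
  have "a = Suc a mod m"
    by (rule vertex_inj[OF assms _ eq]) (use length_ge_3 in \<open>auto intro: mod_less_divisor\<close>)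
  then show False
    using length_ge_3 by (cases rule: Suc_mod_cases[OF assms]) auto
qed

text \<open>Uses \<open>m \<ge> 3\<close>. The vertex found here later serves as a test point
  strictly beyond the side \<open>a\<close>.\<close>

lemma ex_opposite_vertex:
  assumes "a < m"
  obtains b where "\<theta> b \<noteq> \<theta> a" "\<theta> b \<noteq> \<theta> (Suc a)"
proof -
  have "Suc a mod m < m" using length_ge_3 by (auto intro: mod_less_divisor)
  have "{a, Suc a mod m} \<noteq> {..<m}"
  proof
    assume "{a, Suc a mod m} = {..<m}"
    moreover have "card {a, Suc a mod m} \<le> 2" by (simp add: card_insert_if)
    ultimately show False using length_ge_3 by simp
  qed
  then obtain b where b: "b < m" "b \<noteq> a" "b \<noteq> Suc a mod m"
    using assms \<open>Suc a mod m < m\<close> by auto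
  show ?thesis
  proof
    show "\<theta> b \<noteq> \<theta> a" using vertex_inj b assms by blast
    show "\<theta> b \<noteq> \<theta> (Suc a)" using vertex_inj[of b "Suc a mod m"] b \<open>Suc a mod m < m\<close>
      by (auto simp: vertex_mod)
  qed
qed

text \<open>Seen from \<open>\<theta> 0\<close>, the arcs are consecutive intervals of angles. The
  last one has no upper bound: it ends at \<open>\<theta> 0\<close>, whose angle is \<open>0\<close>
  instead of \<open>2\<pi>\<close>.\<close>

lemma side_arc_angle:
  assumes "a < m"
  shows "z \<in> side_arc ts a \<longleftrightarrow> z \<in> circle \<and> Arg2pi (\<theta> a / \<theta> 0) \<le> Arg2pi (z / \<theta> 0) \<and>
    (Suc a < m \<longrightarrow> Arg2pi (z / \<theta> 0) < Arg2pi (\<theta> (Suc a) / \<theta> 0))"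
proof (cases "z \<in> circle")
  case True
  define A where "A = (\<lambda>z. Arg2pi (z / \<theta> 0))"
  have bd: "0 \<le> A z" "A z < 2 * pi" for z using Arg2pi by (auto simp: A_def)
  have fold: "Arg2pi (x / \<theta> 0) = A x" for x by (simp add: A_def)
  have Z: "Arg2pi (z / \<theta> a) = (if A (\<theta> a) \<le> A z then 0 else 2 * pi) + A z - A (\<theta> a)"
    unfolding A_def using Arg2pi_divide_circle[OF vertex_circle[of 0] vertex_circle[of a] True] .
  have S: "Arg2pi (\<theta> (Suc a) / \<theta> a)
    = (if A (\<theta> a) \<le> A (\<theta> (Suc a)) then 0 else 2 * pi) + A (\<theta> (Suc a)) - A (\<theta> a)"
    unfolding A_def using Arg2pi_divide_circle[OF vertex_circle[of 0] vertex_circle[of a] vertex_circle] .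
  have mem: "z \<in> side_arc ts a \<longleftrightarrow> Arg2pi (z / \<theta> a) < Arg2pi (\<theta> (Suc a) / \<theta> a)"
    using True by (simp add: side_arc_def ccw_arc_def)
  show ?thesis
  proof (cases rule: Suc_mod_cases[OF assms])
    case 1
    then have "A (\<theta> a) < A (\<theta> (Suc a))" using vertex_angle_less[of a "Suc a"] by (simp add: A_def)
    then show ?thesis using True 1 bd[of z] bd[of "\<theta> (Suc a)"] bd[of "\<theta> a"] unfolding mem Z S fold by auto
  next
    case 2
    have A0: "A (\<theta> 0) = 0" using Arg2pi_of_real[of 1] vertex_norm[of 0] by (auto simp: A_def)
    have "\<theta> (Suc a) = \<theta> 0" using vertex_mod[of "Suc a"] 2 by simp
    moreover have "0 < a" using 2 length_ge_3 by simp
    then have "A (\<theta> 0) < A (\<theta> a)" using vertex_angle_less[of 0 a] assms by (simp only: A_def)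
    ultimately show ?thesis using True 2 bd[of z] bd[of "\<theta> a"] A0 unfolding mem Z S fold by auto
  qed
qed (simp add: side_arc_def ccw_arc_def)

lemma side_arc_unique:
  assumes "a < m" "b < m" "z \<in> side_arc ts a" "z \<in> side_arc ts b"
  shows "a = b"
proof -
  have False if "a < b" "b < m" "z \<in> side_arc ts a" "z \<in> side_arc ts b" for a b
  proof -
    have "Arg2pi (z / \<theta> 0) < Arg2pi (\<theta> (Suc a) / \<theta> 0)"
      using that side_arc_angle[of a z] by simp
    also have "\<dots> \<le> Arg2pi (\<theta> b / \<theta> 0)"
    proof (cases "Suc a = b")
      case False
      with that have "Suc a < b" by simp
      with that vertex_angle_less show ?thesis by fastforce
    qed simp
    also have "\<dots> \<le> Arg2pi (z / \<theta> 0)" using that side_arc_angle[of b z] by simp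
    finally show False by simp
  qed
  with assms show ?thesis by (metis nat_neq_iff)
qed

lemma ex_side_arc:
  assumes "z \<in> circle"
  obtains a where "a < m" "z \<in> side_arc ts a"
proof -
  \<comment> \<open>The arc of \<open>z\<close> starts at the last vertex met at or before
    \<open>z\<close>; \<open>S\<close> contains \<open>0\<close>, so its maximum exists.\<close>
  define S where "S = {a. a < m \<and> Arg2pi (\<theta> a / \<theta> 0) \<le> Arg2pi (z / \<theta> 0)}"
  have "Arg2pi (\<theta> 0 / \<theta> 0) = 0" using Arg2pi_of_real[of 1] vertex_norm[of 0] by auto
  then have "0 \<in> S" using length_ge_3 Arg2pi_ge_0[of "z / \<theta> 0"] by (auto simp: S_def simp del: divide_self_if)
  moreover have fin: "finite S" by (simp add: S_def)
  ultimately have a: "Max S \<in> S" and max: "\<And>b. b \<in> S \<Longrightarrow> b \<le> Max S" by (auto intro: Max_in)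
  have "Arg2pi (z / \<theta> 0) < Arg2pi (\<theta> (Suc (Max S)) / \<theta> 0)" if "Suc (Max S) < m"
    using that max[of "Suc (Max S)"] unfolding S_def[THEN eq_reflection] by fastforce
  with a assms have "Max S < m" "z \<in> side_arc ts (Max S)"
    by (auto simp: side_arc_angle S_def)
  then show ?thesis using that by blast
qed

lemma side_index_eq:
  assumes "a < m" "z \<in> side_arc ts a"
  shows "side_index ts z = a"
  unfolding side_index_def using assms side_arc_unique by (intro the_equality) auto

lemma side_index:
  assumes "z \<in> circle"
  shows "side_index ts z < m" "z \<in> side_arc ts (side_index ts z)"
proof -
  obtain a where "a < m" "z \<in> side_arc ts a" using ex_side_arc[OF assms] .
  then show "side_index ts z < m" "z \<in> side_arc ts (side_index ts z)"
    using side_index_eq[of a z] by auto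
qed

section \<open>Sides of the ideal polygon as half-spaces\<close>

lemma mem_side_arc:
  assumes "a < m"
  shows "z \<in> side_arc ts a \<longleftrightarrow> z \<in> circle \<and> (z = \<theta> a \<or> lorentz (z, 1) (side_normal a) > 0)"
  unfolding side_arc_def side_normal_def
  using mem_ccw_arc[OF vertex_circle vertex_circle vertex_neq_Suc[OF assms]] .

text \<open>A vertex with positive product would lie in the arc \<open>a\<close> as well as in the
  arc that it starts; disjointness makes it the left endpoint of \<open>a\<close>, where the product
  is zero.\<close>

lemma vertex_lorentz_nonpos:
  assumes "a < m"
  shows "lorentz (\<theta> b, 1) (side_normal a) \<le> 0"
proof (rule ccontr)
  assume *: "\<not> ?thesis"
  then have "\<theta> b \<in> side_arc ts a" using mem_side_arc[OF assms] vertex_circle by simp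
  moreover have "b mod m < m" using length_ge_3 by (auto intro: mod_less_divisor)
  then have "\<theta> b \<in> side_arc ts (b mod m)" using mem_side_arc[of "b mod m"] vertex_circle by (simp add: vertex_mod)
  ultimately have "b mod m = a" using side_arc_unique \<open>b mod m < m\<close> assms by blast
  then have "\<theta> b = \<theta> a" using vertex_mod by metis
  then have "lorentz (\<theta> b, 1) (side_normal a) = 0"
    unfolding side_normal_def
    using lorentz_null_normal_eq_0[OF vertex_circle vertex_circle vertex_neq_Suc[OF assms] vertex_circle] by blast
  with * show False by simp
qed

lemma side_normal_self: "a < m \<Longrightarrow> lorentz (side_normal a) (side_normal a) = 1"
  unfolding side_normal_def by (intro lorentz_normal_self vertex_circle vertex_neq_Suc)

lemma lorentz_side_normal_eq_0:
  assumes "a < m" "z \<in> circle"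
  shows "lorentz (z, 1) (side_normal a) = 0 \<longleftrightarrow> z = \<theta> a \<or> z = \<theta> (Suc a)"
  unfolding side_normal_def
  by (intro lorentz_null_normal_eq_0 vertex_circle vertex_neq_Suc assms)

lemma lorentz_opposite_sides:
  assumes "a < m" "b < m" "a \<noteq> b" "z \<in> circle" "lorentz (z, 1) (side_normal a) \<ge> 0"
  shows "lorentz (z, 1) (side_normal b) \<le> 0"
proof (cases "lorentz (z, 1) (side_normal a) = 0")
  case True
  then show ?thesis using assms lorentz_side_normal_eq_0 vertex_lorentz_nonpos by metis
next
  case False
  with assms have "z \<in> side_arc ts a" by (simp add: mem_side_arc)
  with assms side_arc_unique have "z \<notin> side_arc ts b" by blast
  with assms show ?thesis by (simp add: mem_side_arc)
qed

lemma side_reflect_circle: "a < m \<Longrightarrow> z \<in> circle \<Longrightarrow> side_reflect ts a z \<in> circle"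
  unfolding side_reflect_def by (intro reflect_circle vertex_circle vertex_neq_Suc)

lemma side_reflect_involution: "a < m \<Longrightarrow> z \<in> circle \<Longrightarrow> side_reflect ts a (side_reflect ts a z) = z"
  unfolding side_reflect_def by (intro reflect_involution vertex_circle vertex_neq_Suc)

lemma side_reflect_swaps_sides:
  assumes "a < m" "z \<in> circle"
  shows "lorentz (side_reflect ts a z, 1) (side_normal a) < 0 \<longleftrightarrow> lorentz (z, 1) (side_normal a) > 0"
    and "lorentz (side_reflect ts a z, 1) (side_normal a) > 0 \<longleftrightarrow> lorentz (z, 1) (side_normal a) < 0"
  unfolding side_reflect_def side_normal_def
  using reflect_swaps_sides[OF vertex_circle vertex_circle vertex_neq_Suc[OF assms(1)] assms(2)] by auto

lemma lorentz_reflect_side_normal: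
  assumes "a < m" "z \<in> circle"
  obtains c where "c > 0" "lorentz_reflect (side_normal a) (z, 1) = c *\<^sub>R (side_reflect ts a z, 1)"
  using lorentz_reflect_null[OF vertex_circle vertex_circle vertex_neq_Suc[OF assms(1)] assms(2)]
  unfolding side_reflect_def side_normal_def by blast

lemma ex_opposite_vertex_neg:
  assumes "a < m"
  obtains b where "lorentz (\<theta> b, 1) (side_normal a) < 0"
proof -
  obtain b where b: "\<theta> b \<noteq> \<theta> a" "\<theta> b \<noteq> \<theta> (Suc a)" using ex_opposite_vertex[OF assms] .
  then have "lorentz (\<theta> b, 1) (side_normal a) \<noteq> 0"
    using lorentz_side_normal_eq_0[OF assms vertex_circle] by simp
  with vertex_lorentz_nonpos[OF assms, of b] show ?thesis by (intro that[of b]) simp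
qed

lemma side_normals_le_minus_1:
  assumes "a < m" "b < m" "a \<noteq> b"
  shows "lorentz (side_normal a) (side_normal b) \<le> -1"
proof -
  obtain d where d: "lorentz (\<theta> d, 1) (side_normal a) < 0" using ex_opposite_vertex_neg[OF assms(1)] .
  \<comment> \<open>A test point inside the arc \<open>a\<close>: the mirror image of a vertex
    strictly beyond the side.\<close>
  define z where "z = side_reflect ts a (\<theta> d)"
  have z: "z \<in> circle" unfolding z_def by (intro side_reflect_circle assms vertex_circle)
  have pos: "lorentz (z, 1) (side_normal a) > 0"
    unfolding z_def using side_reflect_swaps_sides(2)[OF assms(1) vertex_circle] d by simp
  have "lorentz (z, 1) (side_normal b) \<le> 0"
    using lorentz_opposite_sides[OF assms z] pos by simp
  with pos z show ?thesis
    unfolding side_normal_def[of b]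
    using lorentz_normal_le_minus_1[OF vertex_circle vertex_circle vertex_neq_Suc[OF assms(2)]
       side_normal_self[OF assms(1)] vertex_lorentz_nonpos[OF assms(1)] vertex_lorentz_nonpos[OF assms(1)]] by blast
qed

lemma int_vec_side_normal:
  assumes "a < m"
  shows "int_vec (side_normal a)"
proof -
  have "unimodular_arc (ts ! a) (ts ! (Suc a mod m))"
    using unimodular assms by (simp add: unimodular_partition_def)
  then show ?thesis
    using int_vec_normal[of "ts ! a" "ts ! (Suc a mod m)"] vertex_neq_Suc[OF assms] assms
    by (simp add: side_normal_def vertex_def)
qed

section \<open>Orbits of nonterminating points\<close>

lemma billiard_factor_circle: "z \<in> circle \<Longrightarrow> B z \<in> circle"
  unfolding billiard_factor_def by (intro side_reflect_circle side_index)

text \<open>Arcs contain their left endpoint, but that is a vertex, which terminates at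
  once.\<close>

lemma nonterminating_interior:
  assumes "z \<in> circle" "\<not> terminating ts z"
  shows "lorentz (z, 1) (side_normal (side_index ts z)) > 0"
proof -
  have "z \<noteq> \<theta> (side_index ts z)"
  proof
    assume "z = \<theta> (side_index ts z)"
    then have "(B ^^ 0) z = \<theta> (side_index ts z)" by simp
    with assms side_index(1)[OF assms(1)] show False unfolding terminating_def by blast
  qed
  then show ?thesis using side_index[OF assms(1)] mem_side_arc by auto
qed

lemma nonterminating_billiard_factor:
  assumes "\<not> terminating ts z"
  shows "\<not> terminating ts (B z)"
proof
  assume "terminating ts (B z)"
  then obtain h a where "a < m" "(B ^^ h) (B z) = \<theta> a" unfolding terminating_def by blast
  then have "(B ^^ Suc h) z = \<theta> a" by (simp add: funpow_swap1)
  with assms \<open>a < m\<close> show False unfolding terminating_def by blast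
qed

lemma terminating_step:
  assumes "terminating ts z"
  shows "(\<exists>a<m. z = \<theta> a) \<or> terminating ts (B z)"
proof -
  obtain h a where "a < m" and h: "(B ^^ h) z = \<theta> a" using assms unfolding terminating_def by blast
  show ?thesis
  proof (cases h)
    case 0 with h \<open>a < m\<close> show ?thesis by auto
  next
    case (Suc k)
    with h have "(B ^^ k) (B z) = \<theta> a" by (simp add: funpow_swap1)
    with \<open>a < m\<close> show ?thesis unfolding terminating_def by blast
  qed
qed

lemma vertex_terminating: "terminating ts (\<theta> a)"
proof -
  have "a mod m < m" using length_ge_3 by (auto intro: mod_less_divisor)
  moreover have "(B ^^ 0) (\<theta> a) = \<theta> (a mod m)" by (simp add: vertex_mod)
  ultimately show ?thesis unfolding terminating_def by blast
qed

lemma billiard_factor_orbit: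
  assumes "z \<in> circle"
  shows "(B ^^ t) z \<in> circle"
proof (induction t)
  case 0
  show ?case using assms by simp
next
  case (Suc t)
  then show ?case using billiard_factor_circle[OF Suc] by simp
qed

lemma nonterminating_orbit:
  assumes "\<not> terminating ts z"
  shows "\<not> terminating ts ((B ^^ t) z)"
  by (induction t) (auto simp: assms nonterminating_billiard_factor)

text \<open>The composition of reflections that carries the point \<open>(B ^^ t) z\<close> of an orbit with
  itinerary \<open>b\<close> back to \<open>z\<close>.\<close>

fun itinerary_iso :: "(nat \<Rightarrow> nat) \<Rightarrow> nat \<Rightarrow> complex \<times> real \<Rightarrow> complex \<times> real" where
  "itinerary_iso b 0 x = x"
| "itinerary_iso b (Suc t) x = itinerary_iso b t (lorentz_reflect (side_normal (b t)) x)"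

lemma itinerary_iso_scale: "itinerary_iso b t (c *\<^sub>R x) = c *\<^sub>R itinerary_iso b t x"
  by (induction t arbitrary: x) (auto simp: lorentz_reflect_scale)

lemma itinerary_iso_lorentz:
  assumes "\<And>t. b t < m"
  shows "lorentz (itinerary_iso b t x) (itinerary_iso b t y) = lorentz x y"
  by (induction t arbitrary: x y) (auto simp: lorentz_reflect_lorentz side_normal_self assms)

lemma itinerary_iso_null:
  assumes "\<And>t. b t < m" "z \<in> circle"
  shows "\<exists>c z'. c > 0 \<and> z' \<in> circle \<and> itinerary_iso b t (z, 1) = c *\<^sub>R (z', 1)"
  using assms(2)
proof (induction t arbitrary: z)
  case 0
  then show ?case by (intro exI[of _ 1] exI[of _ z]) auto
next
  case (Suc t)
  obtain c where c: "c > 0" "lorentz_reflect (side_normal (b t)) (z, 1) = c *\<^sub>R (side_reflect ts (b t) z, 1)"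
    using lorentz_reflect_side_normal[OF assms(1) Suc.prems] .
  obtain d z' where d: "d > 0" "z' \<in> circle" "itinerary_iso b t (side_reflect ts (b t) z, 1) = d *\<^sub>R (z', 1)"
    using Suc.IH[OF side_reflect_circle[OF assms(1) Suc.prems]] by blast
  show ?case
    using c d by (intro exI[of _ "c * d"] exI[of _ z'])
      (simp del: scaleR_Pair mem_sphere_0 add: itinerary_iso_scale)
qed

lemma int_vec_itinerary_iso:
  assumes "\<And>t. b t < m" "int_vec x"
  shows "int_vec (itinerary_iso b t x)"
  using assms(2)
proof (induction t arbitrary: x)
  case (Suc t)
  then show ?case using int_vec_lorentz_reflect[OF int_vec_side_normal[OF assms(1)]] by simp
qed simp

lemma itinerary_iso_orbit:
  assumes "\<And>t. b t < m" "z \<in> circle" "\<And>t. side_index ts ((B ^^ t) z) = b t"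
  shows "\<exists>c>0. itinerary_iso b t ((B ^^ t) z, 1) = c *\<^sub>R (z, 1)"
proof (induction t)
  case 0
  show ?case by (intro exI[of _ 1]) simp
next
  case (Suc t)
  define y where "y = (B ^^ t) z"
  have y: "y \<in> circle" using billiard_factor_orbit assms(2) by (simp only: y_def)
  have By: "(B ^^ Suc t) z = side_reflect ts (b t) y"
    using assms(3)[of t] by (simp add: y_def billiard_factor_def)
  obtain d where d: "d > 0" "itinerary_iso b t (y, 1) = d *\<^sub>R (z, 1)"
    using Suc.IH by (auto simp only: y_def)
  obtain c where c: "c > 0" "lorentz_reflect (side_normal (b t)) (side_reflect ts (b t) y, 1)
    = c *\<^sub>R (side_reflect ts (b t) (side_reflect ts (b t) y), 1)"
    using lorentz_reflect_side_normal[OF assms(1) side_reflect_circle[OF assms(1) y]] .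
  show ?case
    unfolding By using c d
    by (intro exI[of _ "c * d"]) (simp del: scaleR_Pair add: itinerary_iso_scale side_reflect_involution[OF assms(1) y])
qed

lemma equal_itineraries:
  assumes \<sigma>: "\<sigma> \<in> circle" "\<not> terminating ts \<sigma>" and \<rho>: "\<rho> \<in> circle" "\<not> terminating ts \<rho>"
    and eq: "\<And>t. side_index ts ((B ^^ t) \<sigma>) = side_index ts ((B ^^ t) \<rho>)"
  shows "\<sigma> = \<rho>"
proof (rule ccontr)
  assume "\<sigma> \<noteq> \<rho>"
  define b where "b t = side_index ts ((B ^^ t) \<sigma>)" for t
  have b: "b t < m" for t unfolding b_def by (intro side_index billiard_factor_orbit \<sigma>)
  \<comment> \<open>The normal of the arc visited at time \<open>t\<close>, carried back to time 0.
    Both points turn out to lie in its half-space.\<close>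
  define u where "u t = itinerary_iso b t (side_normal (b t))" for t
  note iso = itinerary_iso_lorentz[of b, OF b]
  have u_self: "lorentz (u t) (u t) = 1" for t
    by (simp add: u_def iso side_normal_self b)
  have pos: "lorentz (z, 1) (u t) > 0"
    if z: "z \<in> circle" "\<not> terminating ts z" "\<And>t. side_index ts ((B ^^ t) z) = b t" for z t
  proof -
    obtain c where c: "c > 0" "itinerary_iso b t ((B ^^ t) z, 1) = c *\<^sub>R (z, 1)"
      using itinerary_iso_orbit[OF b z(1,3)] by blast
    have "lorentz (c *\<^sub>R (z, 1)) (u t) = lorentz ((B ^^ t) z, 1) (side_normal (b t))"
      unfolding c(2)[symmetric] u_def by (rule iso)
    also have "\<dots> > 0"
      unfolding z(3)[symmetric]
      by (intro nonterminating_interior billiard_factor_orbit nonterminating_orbit z)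
    finally show ?thesis using c(1) unfolding lorentz_scale_left by (simp add: zero_less_mult_iff)
  qed
  \<comment> \<open>A reflection moves the inside of its arc to the outside, so no symbol is
    repeated at once.\<close>
  have b_neq: "b t \<noteq> b (Suc t)" for t
  proof
    assume t: "b t = b (Suc t)"
    define y where "y = (B ^^ t) \<sigma>"
    have y: "y \<in> circle" "\<not> terminating ts y"
      using billiard_factor_orbit nonterminating_orbit \<sigma> by (simp_all only: y_def not_False_eq_True)
    have By: "(B ^^ Suc t) \<sigma> = side_reflect ts (b t) y" by (simp add: y_def b_def billiard_factor_def)
    have "lorentz (y, 1) (side_normal (b t)) > 0"
      using nonterminating_interior[OF y] by (simp add: b_def y_def)
    moreover have "lorentz (side_reflect ts (b t) y, 1) (side_normal (b (Suc t))) > 0"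
      using nonterminating_interior[OF billiard_factor_orbit[OF \<sigma>(1)] nonterminating_orbit[OF \<sigma>(2)], of "Suc t"]
      unfolding b_def[symmetric] unfolding By .
    ultimately show False
      using side_reflect_swaps_sides(1)[OF b y(1), of t] t by simp
  qed
  have less: "snd (u t) < snd (u (Suc t))" for t
  proof -
    define W W' where "W = side_normal (b t)" and "W' = side_normal (b (Suc t))"
    have W: "lorentz W W = 1" by (simp add: W_def side_normal_self b)
    have u_Suc: "u (Suc t) = itinerary_iso b t (lorentz_reflect W W')" by (simp add: u_def W_def W'_def)
    have u_t: "u t = itinerary_iso b t W" by (simp add: u_def W_def)
    have flip: "lorentz x (lorentz_reflect W y) = lorentz (lorentz_reflect W x) y" for x y
      using lorentz_reflect_lorentz[OF W, of "lorentz_reflect W x" y] lorentz_reflect_involution[OF W] by metis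
    \<comment> \<open>Both vectors are images under one isometry, of \<open>W\<close> and of the
      reflection of \<open>W'\<close> in \<open>W\<close>. The reflection is self-adjoint and
      negates \<open>W\<close>, which leaves \<open>- lorentz W W'\<close>; disjointness of the arcs
      makes this at least 1.\<close>
    have "lorentz (u t) (u (Suc t)) = - lorentz W W'"
      unfolding u_Suc u_t iso flip using W by (simp add: lorentz_reflect_def lorentz_diff_left lorentz_scale_left)
    moreover have "lorentz W W' \<le> -1"
      unfolding W_def W'_def by (intro side_normals_le_minus_1 b b_neq)
    ultimately have uu: "lorentz (u t) (u (Suc t)) \<ge> 1" by simp
    obtain d where d: "lorentz (\<theta> d, 1) W < 0" using ex_opposite_vertex_neg[OF b] unfolding W_def .
    \<comment> \<open>The witness for strict nesting: a vertex beyond the side \<open>b t\<close>,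
      reflected into the arc. It lies in the half-space of \<open>W\<close> but not in that of the
      reflected \<open>W'\<close>, because no vertex lies inside the arc of \<open>W'\<close>. The
      isometry then carries it to a multiple of a point of the circle.\<close>
    define x where "x = lorentz_reflect W (\<theta> d, 1)"
    have x1: "lorentz x W > 0" using d lorentz_reflect_normal[OF W] by (simp add: x_def)
    have x2: "lorentz x (lorentz_reflect W W') \<le> 0"
      unfolding x_def lorentz_reflect_lorentz[OF W] unfolding W'_def by (intro vertex_lorentz_nonpos b)
    obtain c z where c: "c > 0" "z \<in> circle" "itinerary_iso b t x = c *\<^sub>R (z, 1)"
    proof -
      obtain c z where "c > 0" "z \<in> circle" "itinerary_iso b (Suc t) (\<theta> d, 1) = c *\<^sub>R (z, 1)"
        using itinerary_iso_null[of b "\<theta> d" "Suc t", OF b vertex_circle] by blast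
      then show ?thesis using that by (simp only: itinerary_iso.simps x_def W_def)
    qed
    have "lorentz (c *\<^sub>R (z, 1)) (u t) > 0" "lorentz (c *\<^sub>R (z, 1)) (u (Suc t)) \<le> 0"
      unfolding c(3)[symmetric] u_t u_Suc iso by (fact x1 x2)+
    then have "lorentz (z, 1) (u t) > 0" "lorentz (z, 1) (u (Suc t)) \<le> 0"
      using c(1) unfolding lorentz_scale_left by (auto simp: zero_less_mult_iff mult_le_0_iff)
    then show ?thesis using lorentz_nested_snd_less[OF u_self u_self uu c(2)] by blast
  qed
  have int: "snd (u t) \<in> \<int>" for t
    using int_vec_itinerary_iso[OF b int_vec_side_normal[OF b]] by (simp add: u_def int_vec_def)
  \<comment> \<open>Strictly increasing integers grow by at least 1 per step.\<close>
  have grow: "snd (u t) \<ge> snd (u 0) + real t" for t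
  proof (induction t)
    case (Suc t)
    obtain i j where "snd (u t) = of_int i" "snd (u (Suc t)) = of_int j"
      using int by (metis Ints_cases)
    with less[of t] have "snd (u (Suc t)) \<ge> snd (u t) + 1" by simp
    with Suc show ?case by simp
  qed simp
  define \<delta> where "\<delta> = cmod (\<sigma> - \<rho>)"
  have "\<delta> > 0" using \<open>\<sigma> \<noteq> \<rho>\<close> by (simp add: \<delta>_def)
  \<comment> \<open>Chosen so that \<open>snd (u 0) + real t\<close> exceeds
    \<open>2 / \<delta>\<close>, the bound for an arc containing both points.\<close>
  obtain t :: nat where t: "real t > 2 / \<delta> - snd (u 0)" using reals_Archimedean2 by blast
  have "lorentz (\<sigma>, 1) (u t) > 0" by (rule pos[OF \<sigma>]) (simp add: b_def)
  moreover have "lorentz (\<rho>, 1) (u t) > 0" by (rule pos[OF \<rho>]) (simp add: b_def eq)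
  ultimately have "snd (u t) * \<delta> \<le> 2"
    unfolding \<delta>_def by (intro snd_bound_of_two_points u_self \<sigma> \<rho>)
  then have "snd (u t) \<le> 2 / \<delta>" using \<open>\<delta> > 0\<close> by (simp add: field_simps)
  with grow[of t] t show False by simp
qed

end


context unimodular_billiard
begin

abbreviation "T \<equiv> billiard ts"
abbreviation "D \<equiv> billiard_domain ts"

section \<open>The billiard map on its domain\<close>

definition billiard_inv :: "complex \<times> complex \<Rightarrow> complex \<times> complex" where
  "billiard_inv = prod.swap \<circ> T \<circ> prod.swap"

lemma mem_billiard_domain:
  "(\<sigma>, \<rho>) \<in> D \<longleftrightarrow> \<sigma> \<in> circle \<and> \<rho> \<in> circle \<and> \<not> terminating ts \<sigma> \<and> \<not> terminating ts \<rho> \<and>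
    side_index ts \<sigma> \<noteq> side_index ts \<rho>"
proof -
  have "(\<exists>a<m. \<sigma> \<in> side_arc ts a \<and> \<rho> \<in> side_arc ts a) \<longleftrightarrow> side_index ts \<sigma> = side_index ts \<rho>"
    if "\<sigma> \<in> circle" "\<rho> \<in> circle"
    using side_index[OF that(1)] side_index[OF that(2)] side_index_eq by metis
  then show ?thesis
    unfolding billiard_domain_def phase_space_def by blast
qed

lemma swap_mem_billiard_domain: "prod.swap x \<in> D \<longleftrightarrow> x \<in> D"
  by (cases x) (auto simp: mem_billiard_domain)

lemma billiard_Pair: "T (\<sigma>, \<rho>) = (B \<sigma>, side_reflect ts (side_index ts \<sigma>) \<rho>)"
  by (simp add: billiard_def billiard_factor_def)

text \<open>As \<open>\<rho>\<close> lies outside the arc \<open>a\<close> of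
  \<open>\<sigma>\<close>, its image \<open>\<rho>'\<close> lies inside. Starting from
  \<open>(\<rho>', B \<sigma>)\<close> the billiard therefore reflects in the same side again, so
  the swapped map undoes the step.\<close>

lemma billiard_step:
  assumes "(\<sigma>, \<rho>) \<in> D"
  defines "a \<equiv> side_index ts \<sigma>"
  defines "\<rho>' \<equiv> side_reflect ts a \<rho>"
  shows "T (\<sigma>, \<rho>) = (B \<sigma>, \<rho>')" "(B \<sigma>, \<rho>') \<in> D" "side_index ts \<rho>' = a" "B \<rho>' = \<rho>"
    "side_reflect ts a (B \<sigma>) = \<sigma>"
proof -
  have \<sigma>: "\<sigma> \<in> circle" "\<not> terminating ts \<sigma>" and \<rho>: "\<rho> \<in> circle" "\<not> terminating ts \<rho>"
    and neq: "a \<noteq> side_index ts \<rho>"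
    using assms(1) by (auto simp: mem_billiard_domain a_def)
  have a: "a < m" unfolding a_def by (intro side_index \<sigma>)
  have B\<sigma>: "B \<sigma> = side_reflect ts a \<sigma>" by (simp add: billiard_factor_def a_def)
  have \<rho>': "\<rho>' \<in> circle" unfolding \<rho>'_def by (intro side_reflect_circle a \<rho>)
  show "T (\<sigma>, \<rho>) = (B \<sigma>, \<rho>')" by (simp add: billiard_Pair \<rho>'_def a_def)
  have "\<rho> \<notin> side_arc ts a" using neq side_index_eq a by blast
  then have "lorentz (\<rho>, 1) (side_normal a) \<le> 0" using \<rho> a by (simp add: mem_side_arc)
  moreover have "lorentz (\<rho>, 1) (side_normal a) \<noteq> 0"
    using lorentz_side_normal_eq_0[OF a \<rho>(1)] \<rho>(2) vertex_terminating by metis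
  ultimately have \<rho>'_pos: "lorentz (\<rho>', 1) (side_normal a) > 0"
    unfolding \<rho>'_def side_reflect_swaps_sides(2)[OF a \<rho>(1)] by simp
  then have "\<rho>' \<in> side_arc ts a" using \<rho>' a by (simp add: mem_side_arc)
  then show index: "side_index ts \<rho>' = a" using side_index_eq a by blast
  show B\<rho>': "B \<rho>' = \<rho>"
    unfolding billiard_factor_def index unfolding \<rho>'_def by (intro side_reflect_involution a \<rho>)
  \<comment> \<open>The next point after \<open>\<rho>'\<close> is the nonterminating
    \<open>\<rho>\<close>, and \<open>\<rho>'\<close>, being strictly inside the arc, is not itself
    a vertex.\<close>
  have "\<not> terminating ts \<rho>'"
  proof
    assume "terminating ts \<rho>'"
    then consider d where "\<rho>' = \<theta> d" | "terminating ts (B \<rho>')" using terminating_step by blast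
    then show False
    proof cases
      case 1
      then show False using vertex_lorentz_nonpos[OF a, of d] \<rho>'_pos by simp
    qed (use B\<rho>' \<rho> in simp)
  qed
  moreover have "side_index ts (B \<sigma>) \<noteq> a"
  proof
    assume "side_index ts (B \<sigma>) = a"
    then have "lorentz (B \<sigma>, 1) (side_normal a) > 0"
      using nonterminating_interior[OF billiard_factor_circle[OF \<sigma>(1)] nonterminating_billiard_factor[OF \<sigma>(2)]] by simp
    moreover have "lorentz (\<sigma>, 1) (side_normal a) > 0"
      using nonterminating_interior[OF \<sigma>] by (simp add: a_def)
    ultimately show False using side_reflect_swaps_sides(1)[OF a \<sigma>(1)] by (simp add: B\<sigma>)
  qed
  ultimately show "(B \<sigma>, \<rho>') \<in> D"
    unfolding mem_billiard_domain index
    using \<rho>' billiard_factor_circle[OF \<sigma>(1)] nonterminating_billiard_factor[OF \<sigma>(2)] by blast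
  show "side_reflect ts a (B \<sigma>) = \<sigma>" unfolding B\<sigma> by (intro side_reflect_involution a \<sigma>)
qed

lemma billiard_mem: "x \<in> D \<Longrightarrow> T x \<in> D"
  using billiard_step by (cases x) auto

lemma billiard_inv_billiard:
  assumes "x \<in> D"
  shows "billiard_inv (T x) = x"
proof -
  obtain \<sigma> \<rho> where x: "x = (\<sigma>, \<rho>)" by (cases x)
  show ?thesis
    using billiard_step[of \<sigma> \<rho>] assms unfolding x by (simp add: billiard_inv_def billiard_Pair)
qed

lemma billiard_inv_mem: "x \<in> D \<Longrightarrow> billiard_inv x \<in> D"
  unfolding billiard_inv_def o_def swap_mem_billiard_domain
  by (intro billiard_mem) (simp only: swap_mem_billiard_domain)

lemma billiard_billiard_inv:
  assumes "x \<in> D"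
  shows "T (billiard_inv x) = x"
proof -
  have "billiard_inv (T (prod.swap x)) = prod.swap x"
    using assms billiard_inv_billiard swap_mem_billiard_domain by blast
  then have "prod.swap (T (billiard_inv x)) = prod.swap x"
    by (simp add: billiard_inv_def)
  then show ?thesis by (metis swap_swap)
qed

lemma bij_betw_billiard: "bij_betw T D D"
  by (rule bij_betw_byWitness[where f' = billiard_inv])
    (auto simp: billiard_inv_billiard billiard_billiard_inv billiard_mem billiard_inv_mem)

lemma snd_billiard_inv:
  assumes "x \<in> D"
  shows "snd (billiard_inv x) = B (snd x)" "side_index ts (fst (billiard_inv x)) = side_index ts (snd x)"
proof -
  obtain \<sigma> \<rho> where x: "x = (\<sigma>, \<rho>)" by (cases x)
  have "(\<rho>, \<sigma>) \<in> D" using assms swap_mem_billiard_domain[of "(\<sigma>, \<rho>)"] by (simp add: x)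
  from billiard_step[OF this]
  show "snd (billiard_inv x) = B (snd x)" "side_index ts (fst (billiard_inv x)) = side_index ts (snd x)"
    by (simp_all add: billiard_inv_def x)
qed

lemma billiard_inv_orbit:
  assumes "x \<in> D"
  shows "(billiard_inv ^^ t) x \<in> D"
  by (induction t) (auto simp: assms billiard_inv_mem)

lemma snd_billiard_inv_orbit:
  assumes "x \<in> D"
  shows "snd ((billiard_inv ^^ t) x) = (B ^^ t) (snd x)"
proof (induction t)
  case (Suc t)
  then show ?case using snd_billiard_inv(1)[OF billiard_inv_orbit[OF assms, of t]] by simp
qed simp

text \<open>A backward step reflects in the side of the second coordinate and brings the first
  coordinate into that arc. So the sides of the first coordinates of the preimages spell out the
  itinerary of the second coordinate, which determines it.\<close>

lemma fst_past_determines: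
  assumes x: "x \<in> D" and y: "y \<in> D"
    and eq: "\<And>t. fst ((billiard_inv ^^ t) x) = fst ((billiard_inv ^^ t) y)"
  shows "x = y"
proof -
  \<comment> \<open>Shift by one: symbol \<open>t\<close> of \<open>snd z\<close> is seen at the
    preimage of order \<open>Suc t\<close>.\<close>
  have index: "side_index ts ((B ^^ t) (snd z)) = side_index ts (fst ((billiard_inv ^^ Suc t) z))"
    if "z \<in> D" for z t
    using snd_billiard_inv(2)[OF billiard_inv_orbit[OF that, of t]]
    unfolding snd_billiard_inv_orbit[OF that] by simp
  have mem: "snd z \<in> circle" "\<not> terminating ts (snd z)" if "z \<in> D" for z
    using that mem_billiard_domain[of "fst z" "snd z"] by auto
  have "snd x = snd y"
  proof (rule equal_itineraries)
    show "side_index ts ((B ^^ t) (snd x)) = side_index ts ((B ^^ t) (snd y))" for t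
      unfolding index[OF x] index[OF y] eq ..
  qed (use mem x y in blast)+
  moreover have "fst x = fst y" using eq[of 0] by simp
  ultimately show ?thesis by (rule prod_eqI[rotated])
qed

text \<open>Outside the domain both coordinates share an arc, so the second one moves by
  \<open>B\<close> as well. An orbit that never enters the domain would thus have coordinates with
  equal itineraries.\<close>

lemma billiard_eventually_mem:
  assumes "(\<sigma>, \<rho>) \<in> phase_space" "\<not> terminating ts \<sigma>" "\<not> terminating ts \<rho>"
  shows "\<exists>t. (T ^^ t) (\<sigma>, \<rho>) \<in> D"
proof (rule ccontr)
  assume *: "\<not> ?thesis"
  have c: "\<sigma> \<in> circle" "\<rho> \<in> circle" "\<sigma> \<noteq> \<rho>" using assms(1) by (auto simp: phase_space_def)
  have index: "side_index ts ((B ^^ t) \<sigma>) = side_index ts ((B ^^ t) \<rho>)"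
    if "(T ^^ t) (\<sigma>, \<rho>) = ((B ^^ t) \<sigma>, (B ^^ t) \<rho>)" for t
  proof -
    have "((B ^^ t) \<sigma>, (B ^^ t) \<rho>) \<notin> D" using * that by metis
    then show ?thesis
      unfolding mem_billiard_domain
      using billiard_factor_orbit[OF c(1)] billiard_factor_orbit[OF c(2)]
        nonterminating_orbit[OF assms(2)] nonterminating_orbit[OF assms(3)] by blast
  qed
  have "(T ^^ t) (\<sigma>, \<rho>) = ((B ^^ t) \<sigma>, (B ^^ t) \<rho>)" for t
  proof (induction t)
    case (Suc t)
    then show ?case using index[OF Suc] by (simp add: billiard_Pair billiard_factor_def[of ts "(B ^^ t) \<rho>"])
  qed simp
  then have "\<sigma> = \<rho>" using equal_itineraries[OF c(1) assms(2) c(2) assms(3)] index by blast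
  with c show False by simp
qed

end


section \<open>Invariance of the geodesic measure\<close>

definition moebius :: "real \<Rightarrow> real \<Rightarrow> real \<Rightarrow> real \<Rightarrow> real \<Rightarrow> real" where
  "moebius a b c d x = (a * x + b) / (c * x + d)"

lemma borel_measurable_moebius [measurable]: "moebius a b c d \<in> borel_measurable borel"
  unfolding moebius_def by measurable

text \<open>At the pole the Jacobian is \<open>x / 0 = 0\<close>, so no exceptional point has to be removed.\<close>

lemma lborel_eq_distr_moebius:
  assumes det: "a * d - b * c \<noteq> 0"
  shows "lborel = distr (density lborel (\<lambda>x. ennreal \<bar>(a * d - b * c) / (c * x + d)\<^sup>2\<bar>)) borel (moebius a b c d)"
proof (rule lborel_eqI)
  fix l u :: real
  assume *: "\<And>e. e \<in> Basis \<Longrightarrow> l \<bullet> e \<le> u \<bullet> e"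
  then have "l \<le> u" by simp
  define S where "S = {x. c * x + d \<noteq> 0}"
  define g where "g = moebius a b c d"
  define g' where "g' x = (a * d - b * c) / (c * x + d)\<^sup>2" for x
  define f :: "real \<Rightarrow> real" where "f = indicator (box l u)"
  have [measurable]: "g \<in> borel_measurable borel" by (simp add: g_def)
  have "open S" unfolding S_def by (intro open_Collect_neq continuous_intros)
  then have "S \<in> sets lborel" by simp
  then have S: "S \<in> sets lebesgue" by (rule sets_completionI_sets)
  have der: "(g has_field_derivative g' x) (at x within S)" if "x \<in> S" for x
    using that unfolding g_def g'_def moebius_def[abs_def] S_def
    by (auto intro!: derivative_eq_intros simp: power2_eq_square algebra_simps)
  have inj: "inj_on g S"
  proof (rule inj_onI)
    fix x y assume "x \<in> S" "y \<in> S" "g x = g y"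
    then have "(a * x + b) * (c * y + d) = (a * y + b) * (c * x + d)"
      by (simp add: g_def moebius_def S_def field_simps)
    then have "(a * d - b * c) * (x - y) = 0" by (simp add: algebra_simps)
    then show "x = y" using det by simp
  qed
  \<comment> \<open>The inverse Moebius map supplies the preimage; only the value
    \<open>a / c\<close> can be missed, and a point is negligible.\<close>
  have onto: "y \<in> g ` S" if "c * y \<noteq> a" for y
  proof (rule image_eqI)
    define x where "x = (d * y - b) / (a - c * y)"
    have nz: "a - c * y \<noteq> 0" using that by simp
    have "c * x + d = (a * d - b * c) / (a - c * y)"
      using nz by (simp add: x_def field_simps)
    moreover have "a * x + b = y * (a * d - b * c) / (a - c * y)"
      using nz by (simp add: x_def field_simps)
    ultimately show "y = g ((d * y - b) / (a - c * y))" "(d * y - b) / (a - c * y) \<in> S"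
      using nz det by (simp_all add: g_def moebius_def S_def flip: x_def)
  qed
  have "negligible (- (g ` S))"
  proof (rule negligible_subset)
    show "- (g ` S) \<subseteq> {a / c}"
    proof
      fix y assume "y \<in> - (g ` S)"
      then have "c * y = a" using onto by blast
      moreover from this have "c \<noteq> 0" using det by auto
      ultimately show "y \<in> {a / c}" by (auto simp: field_simps)
    qed
  qed simp
  then have "(f has_integral u - l) UNIV \<longleftrightarrow> (f has_integral u - l) (g ` S)"
    by (intro has_integral_spike_set_eq) (auto elim: negligible_subset)
  moreover have "(f has_integral u - l) UNIV"
  proof -
    have "((\<lambda>_. 1) has_integral u - l) (box l u)"
      using has_integral_measure_lborel[of "box l u"] \<open>l \<le> u\<close> by simp
    then have "((\<lambda>x. if x \<in> box l u then 1 else 0) has_integral u - l) UNIV"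
      by (simp only: has_integral_restrict_UNIV)
    moreover have "f = (\<lambda>x. if x \<in> box l u then 1 else 0)"
      by (auto simp: f_def indicator_def)
    ultimately show ?thesis by simp
  qed
  ultimately have "(f has_integral u - l) (g ` S)" by simp
  \<comment> \<open>Nonnegativity upgrades the integral to an absolute one, as the change of
    variables formula requires.\<close>
  then have "f absolutely_integrable_on (g ` S)" "integral (g ` S) f = u - l"
    by (auto intro: nonnegative_absolutely_integrable_1 simp: f_def has_integral_iff)
  then have "(\<lambda>x. \<bar>g' x\<bar> * f (g x)) absolutely_integrable_on S" "integral S (\<lambda>x. \<bar>g' x\<bar> * f (g x)) = u - l"
    using has_absolute_integral_change_of_variables_1'[OF S der inj, of f "u - l"] by auto
  then have "((\<lambda>x. \<bar>g' x\<bar> * f (g x)) has_integral u - l) S"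
    using set_lebesgue_integral_eq_integral(1) by (auto simp: has_integral_iff)
  then have "((\<lambda>x. if x \<in> S then \<bar>g' x\<bar> * f (g x) else 0) has_integral u - l) UNIV"
    by (simp only: has_integral_restrict_UNIV)
  moreover have "(\<lambda>x. if x \<in> S then \<bar>g' x\<bar> * f (g x) else 0) = (\<lambda>x. \<bar>g' x\<bar> * f (g x))"
    by (auto simp: S_def g'_def)
  ultimately have int: "((\<lambda>x. \<bar>g' x\<bar> * f (g x)) has_integral u - l) UNIV" by simp
  have g'_meas: "g' \<in> borel_measurable borel" unfolding g'_def[abs_def] by measurable
  have "emeasure (distr (density lborel (\<lambda>x. ennreal \<bar>g' x\<bar>)) borel g) (box l u)
    = (\<integral>\<^sup>+x. ennreal \<bar>g' x\<bar> * indicator (g -` box l u) x \<partial>lborel)"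
    using g'_meas measurable_sets_borel[of g borel "box l u"]
    by (subst emeasure_distr) (auto intro!: emeasure_density)
  also have "\<dots> = (\<integral>\<^sup>+x. ennreal (\<bar>g' x\<bar> * f (g x)) \<partial>lborel)"
    by (intro nn_integral_cong) (auto simp: f_def indicator_def)
  also have "\<dots> = ennreal (u - l)"
    by (rule nn_integral_has_integral_lborel[OF _ _ int]) (use g'_meas in \<open>auto simp: f_def\<close>)
  finally show "emeasure (distr (density lborel (\<lambda>x. ennreal \<bar>(a * d - b * c) / (c * x + d)\<^sup>2\<bar>)) borel
      (moebius a b c d)) (box l u) = ennreal (\<Prod>b\<in>Basis. (u - l) \<bullet> b)"
    by (simp add: g_def g'_def)
qed simp

lemma nn_integral_moebius:
  fixes F :: "real \<Rightarrow> ennreal"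
  assumes "a * d - b * c \<noteq> 0" and [measurable]: "F \<in> borel_measurable borel"
  shows "(\<integral>\<^sup>+x. ennreal \<bar>(a * d - b * c) / (c * x + d)\<^sup>2\<bar> * F (moebius a b c d x) \<partial>lborel)
    = (\<integral>\<^sup>+x. F x \<partial>lborel)"
  by (subst (2) lborel_eq_distr_moebius[OF assms(1)])
    (simp add: nn_integral_distr nn_integral_density)

section \<open>The Cayley map and the geodesic measure\<close>

lemma cayley_denominator: "- \<i> * of_real \<omega> + 1 \<noteq> 0"
  by (auto simp: complex_eq_iff)

lemma cayley_circle: "cayley \<omega> \<in> circle"
proof -
  have "of_real \<omega> - \<i> = - \<i> * cnj (- \<i> * of_real \<omega> + 1)"
    by (simp add: complex_eq_iff)
  then have "cmod (of_real \<omega> - \<i>) = cmod (- \<i> * of_real \<omega> + 1)"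
    by (metis complex_mod_cnj norm_ii norm_minus_cancel norm_mult mult_1)
  then show ?thesis
    using cayley_denominator[of \<omega>] unfolding cayley_def by (simp add: norm_divide)
qed

lemma cayley_inj: "cayley \<omega> = cayley \<alpha> \<longleftrightarrow> \<omega> = \<alpha>"
proof
  assume "cayley \<omega> = cayley \<alpha>"
  then have "(of_real \<omega> - \<i>) * (- \<i> * of_real \<alpha> + 1) = (of_real \<alpha> - \<i>) * (- \<i> * of_real \<omega> + 1)"
    using cayley_denominator[of \<omega>] cayley_denominator[of \<alpha>] unfolding cayley_def
    by (simp add: frac_eq_eq)
  then show "\<omega> = \<alpha>" by (simp add: complex_eq_iff algebra_simps)
qed simp

lemma borel_measurable_cayley [measurable]: "cayley \<in> borel_measurable borel"
  unfolding cayley_def[abs_def] by measurable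

lemma phase_space_borel [measurable]: "phase_space \<in> sets borel"
proof -
  have "phase_space = (circle \<times> circle) \<inter> {x. fst x \<noteq> snd x}" by (auto simp: phase_space_def)
  moreover have "closed (circle \<times> circle)" by (intro closed_Times closed_sphere)
  moreover have "open {x::complex \<times> complex. fst x \<noteq> snd x}"
    by (intro open_Collect_neq continuous_intros)
  ultimately show ?thesis by (metis borel_closed borel_open sets.Int)
qed

lemma space_geodesic_measure [simp]: "space geodesic_measure = phase_space"
  by (simp add: geodesic_measure_def space_restrict_space)

lemma sets_geodesic_measure: "sets geodesic_measure = sets (restrict_space borel phase_space)"
  by (simp add: geodesic_measure_def)

lemma mem_sets_geodesic_measure: "A \<in> sets geodesic_measure \<longleftrightarrow> A \<in> sets borel \<and> A \<subseteq> phase_space"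
  unfolding sets_geodesic_measure by (auto simp: sets_restrict_space_iff)

definition hyperbolic_density :: "real \<Rightarrow> real \<Rightarrow> ennreal" where
  "hyperbolic_density \<omega> \<alpha> = ennreal (1 / (\<omega> - \<alpha>)\<^sup>2)"

text \<open>The density vanishes on the diagonal, where it is \<open>1 / 0\<close>, so the integral may range over the
  whole plane.\<close>

lemma emeasure_geodesic_measure:
  assumes "A \<in> sets geodesic_measure"
  shows "emeasure geodesic_measure A =
    (\<integral>\<^sup>+\<omega>. \<integral>\<^sup>+\<alpha>. hyperbolic_density \<omega> \<alpha> * indicator A (cayley \<omega>, cayley \<alpha>) \<partial>lborel \<partial>lborel)"
proof -
  define \<Omega> where "\<Omega> = {(\<omega>::real, \<alpha>). \<omega> \<noteq> \<alpha>}"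
  define C where "C = (\<lambda>(\<omega>, \<alpha>). (cayley \<omega>, cayley \<alpha>))"
  define k where "k = (\<lambda>(\<omega>::real, \<alpha>). ennreal (1 / (\<omega> - \<alpha>)\<^sup>2))"
  have "open {x::real \<times> real. fst x \<noteq> snd x}"
    by (intro open_Collect_neq continuous_intros)
  then have "{x::real \<times> real. fst x \<noteq> snd x} \<in> sets borel" by (rule borel_open)
  moreover have "\<Omega> = {x. fst x \<noteq> snd x}" by (auto simp: \<Omega>_def)
  ultimately have \<Omega> [measurable]: "\<Omega> \<in> sets borel" by simp
  have A [measurable]: "A \<in> sets borel" using assms by (simp add: mem_sets_geodesic_measure)
  have [measurable]: "fst \<in> borel_measurable (borel :: (real \<times> real) measure)"
    "snd \<in> borel_measurable (borel :: (real \<times> real) measure)"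
    by (intro borel_measurable_continuous_onI continuous_intros)+
  have [measurable]: "C \<in> borel_measurable borel"
    unfolding C_def case_prod_beta' by (intro borel_measurable_Pair) measurable
  have [measurable]: "k \<in> borel_measurable borel"
    unfolding k_def case_prod_beta' by measurable
  have C: "C \<in> measurable (density (restrict_space lborel \<Omega>) k) (restrict_space borel phase_space)"
    by (intro measurable_restrict_space2)
      (auto simp: space_restrict_space C_def \<Omega>_def phase_space_def cayley_inj cayley_circle[simplified]
        intro!: measurable_restrict_space1)
  have "emeasure geodesic_measure A = emeasure (density (restrict_space lborel \<Omega>) k) (C -` A \<inter> \<Omega>)"
    unfolding geodesic_measure_def \<Omega>_def[symmetric] k_def[symmetric] C_def[symmetric]
    using C assms by (subst emeasure_distr) (auto simp: sets_geodesic_measure space_restrict_space)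
  also have "\<dots> = (\<integral>\<^sup>+x. k x * indicator (C -` A \<inter> \<Omega>) x \<partial>restrict_space lborel \<Omega>)"
    by (intro emeasure_density) (auto intro!: measurable_restrict_space1 simp: sets_restrict_space_iff
        measurable_sets_borel[OF \<open>C \<in> borel_measurable borel\<close>])
  also have "\<dots> = (\<integral>\<^sup>+x. k x * indicator (C -` A \<inter> \<Omega>) x * indicator \<Omega> x \<partial>lborel)"
    by (intro nn_integral_restrict_space) simp
  also have "\<dots> = (\<integral>\<^sup>+x. k x * indicator A (C x) \<partial>(lborel \<Otimes>\<^sub>M lborel))"
    unfolding lborel_prod by (intro nn_integral_cong) (auto simp: k_def \<Omega>_def indicator_def)
  also have "\<dots> = (\<integral>\<^sup>+\<omega>. \<integral>\<^sup>+\<alpha>. k (\<omega>, \<alpha>) * indicator A (C (\<omega>, \<alpha>)) \<partial>lborel \<partial>lborel)"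
    by (rule lborel.nn_integral_fst[symmetric]) (simp add: lborel_prod)
  finally show ?thesis by (simp add: k_def C_def hyperbolic_density_def)
qed


section \<open>The group action on the circle and on the geodesic measure\<close>

lemma SU11_denominator:
  assumes "(\<alpha>, \<beta>) \<in> SU11_pm" "z \<in> circle"
  shows "cnj \<beta> * z + cnj \<alpha> \<noteq> 0"
proof
  assume "cnj \<beta> * z + cnj \<alpha> = 0"
  then have "cnj \<alpha> = - (cnj \<beta> * z)" by (metis add.commute add_eq_0_iff)
  then have "cmod (cnj \<alpha>) = cmod (cnj \<beta> * z)" by (metis norm_minus_cancel)
  then have "cmod \<alpha> = cmod \<beta>" using assms(2) by (simp add: norm_mult)
  then show False using assms(1) by (simp add: SU11_pm_def)
qed

lemma SU11_act_circle:
  assumes "g \<in> SU11_pm" "z \<in> circle"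
  shows "SU11_act g z \<in> circle"
proof -
  obtain \<alpha> \<beta> where g: "g = (\<alpha>, \<beta>)" by (cases g)
  have "z * cnj z = 1" using assms(2) complex_norm_square[of z] by simp
  then have "\<alpha> * z + \<beta> = z * cnj (cnj \<beta> * z + cnj \<alpha>)"
    by (simp add: algebra_simps)
  then have "cmod (\<alpha> * z + \<beta>) = cmod (cnj \<beta> * z + cnj \<alpha>)"
    using assms(2) by (simp only: norm_mult complex_mod_cnj) simp
  then show ?thesis
    using SU11_denominator[of \<alpha> \<beta> z] assms unfolding g by (simp add: SU11_act_def norm_divide)
qed

lemma SU11_act_inj:
  assumes "g \<in> SU11_pm" "z \<in> circle" "w \<in> circle"
  shows "SU11_act g z = SU11_act g w \<longleftrightarrow> z = w"
proof
  obtain \<alpha> \<beta> where g: "g = (\<alpha>, \<beta>)" by (cases g)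
  assume "SU11_act g z = SU11_act g w"
  then have "(\<alpha> * z + \<beta>) * (cnj \<beta> * w + cnj \<alpha>) = (\<alpha> * w + \<beta>) * (cnj \<beta> * z + cnj \<alpha>)"
    using SU11_denominator[of \<alpha> \<beta>] assms unfolding g by (simp add: SU11_act_def frac_eq_eq)
  then have "(\<alpha> * cnj \<alpha> - \<beta> * cnj \<beta>) * (z - w) = 0" by (simp add: algebra_simps)
  moreover have "\<alpha> * cnj \<alpha> - \<beta> * cnj \<beta> \<noteq> 0"
  proof
    assume "\<alpha> * cnj \<alpha> - \<beta> * cnj \<beta> = 0"
    then have "complex_of_real ((cmod \<alpha>)\<^sup>2) = complex_of_real ((cmod \<beta>)\<^sup>2)"
      by (simp only: complex_norm_square) simp
    then have "(cmod \<alpha>)\<^sup>2 = (cmod \<beta>)\<^sup>2" by (simp only: of_real_eq_iff)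
    then show False using assms(1) by (simp add: g SU11_pm_def)
  qed
  ultimately show "z = w" by simp
qed simp

text \<open>The Moebius coefficients are those of \<open>C\<^sup>-\<^sup>1 g C\<close>, up to a factor 2, for the Cayley matrix \<open>C\<close>.\<close>

lemma SU11_act_cayley:
  assumes "z = cayley \<omega>" "(Re \<beta> - Im \<alpha>) * \<omega> + (Re \<alpha> - Im \<beta>) \<noteq> 0"
  shows "SU11_act (\<alpha>, \<beta>) z =
    cayley (moebius (Re \<alpha> + Im \<beta>) (Im \<alpha> + Re \<beta>) (Re \<beta> - Im \<alpha>) (Re \<alpha> - Im \<beta>) \<omega>)"
proof -
  define P where "P = (Re \<alpha> + Im \<beta>) * \<omega> + (Im \<alpha> + Re \<beta>)"
  define Q where "Q = (Re \<beta> - Im \<alpha>) * \<omega> + (Re \<alpha> - Im \<beta>)"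
  define x y where "x = of_real \<omega> - \<i>" and "y = - \<i> * of_real \<omega> + 1"
  have y: "y \<noteq> 0" unfolding y_def by (rule cayley_denominator)
  have "Q \<noteq> 0" using assms(2) by (simp add: Q_def)
  have N: "\<alpha> * x + \<beta> * y = of_real P - \<i> * of_real Q"
    and E: "cnj \<beta> * x + cnj \<alpha> * y = of_real Q - \<i> * of_real P"
    by (simp_all add: complex_eq_iff x_def y_def P_def Q_def algebra_simps)
  have "SU11_act (\<alpha>, \<beta>) z = (\<alpha> * (x / y) + \<beta>) / (cnj \<beta> * (x / y) + cnj \<alpha>)"
    by (simp add: SU11_act_def assms(1) cayley_def x_def y_def)
  also have "\<alpha> * (x / y) + \<beta> = (\<alpha> * x + \<beta> * y) / y"
    using y by (simp add: field_simps)
  also have "cnj \<beta> * (x / y) + cnj \<alpha> = (cnj \<beta> * x + cnj \<alpha> * y) / y"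
    using y by (simp add: field_simps)
  also have "(\<alpha> * x + \<beta> * y) / y / ((cnj \<beta> * x + cnj \<alpha> * y) / y)
      = (of_real P - \<i> * of_real Q) / (of_real Q - \<i> * of_real P)"
    using y by (simp add: N E)
  also have "\<dots> = ((of_real P - \<i> * of_real Q) / of_real Q) / ((of_real Q - \<i> * of_real P) / of_real Q)"
    using \<open>Q \<noteq> 0\<close> by simp
  also have "(of_real P - \<i> * of_real Q) / of_real Q = of_real (P / Q) - \<i>"
    using \<open>Q \<noteq> 0\<close> by (simp add: diff_divide_distrib)
  also have "(of_real Q - \<i> * of_real P) / of_real Q = - \<i> * of_real (P / Q) + 1"
    using \<open>Q \<noteq> 0\<close> by (simp add: diff_divide_distrib)
  finally show ?thesis by (simp add: cayley_def moebius_def P_def Q_def)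
qed

lemma borel_measurable_SU11_act [measurable]: "SU11_act g \<in> borel_measurable borel"
  unfolding SU11_act_def case_prod_beta by measurable

lemma map_prod_SU11_act_phase_space:
  assumes "g \<in> SU11_pm" "x \<in> phase_space"
  shows "map_prod (SU11_act g) (SU11_act g) x \<in> phase_space"
  using assms SU11_act_inj SU11_act_circle unfolding phase_space_def
  by (auto simp: split_beta simp del: mem_sphere_0)

lemma measurable_fst_snd_complex [measurable]:
  "fst \<in> borel_measurable (borel :: (complex \<times> complex) measure)"
  "snd \<in> borel_measurable (borel :: (complex \<times> complex) measure)"
  by (intro borel_measurable_continuous_onI continuous_intros)+

lemma map_prod_SU11_act_measurable:
  assumes "g \<in> SU11_pm"
  shows "map_prod (SU11_act g) (SU11_act g) \<in> measurable geodesic_measure geodesic_measure"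
proof -
  have "(\<lambda>x. (SU11_act g (fst x), SU11_act g (snd x))) \<in> borel_measurable borel"
    by (intro borel_measurable_Pair) measurable
  then have "map_prod (SU11_act g) (SU11_act g) \<in> borel_measurable borel"
    by (simp add: map_prod_def case_prod_beta')
  then have "map_prod (SU11_act g) (SU11_act g)
    \<in> measurable (restrict_space borel phase_space) (restrict_space borel phase_space)"
    using map_prod_SU11_act_phase_space[OF assms]
    by (intro measurable_restrict_space2 measurable_restrict_space1) (auto simp: space_restrict_space)
  then show ?thesis
    by (simp only: measurable_cong_sets[OF sets_geodesic_measure sets_geodesic_measure])
qed

lemma moebius_diff:
  assumes "c * \<omega> + d \<noteq> 0" "c * \<alpha> + d \<noteq> 0"
  shows "moebius a b c d \<omega> - moebius a b c d \<alpha> = (a * d - b * c) * (\<omega> - \<alpha>) / ((c * \<omega> + d) * (c * \<alpha> + d))"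
  using assms by (simp add: moebius_def divide_simps) (simp add: algebra_simps)

text \<open>The pointwise form of invariance: by \<open>moebius_diff\<close>, the squared difference
  is multiplied by both derivatives up to sign. The factors are nested so that each can be absorbed
  by a change of variable in its own integral. On the diagonal both densities are
  \<open>1 / 0 = 0\<close>.\<close>

lemma hyperbolic_density_moebius:
  assumes "a * d - b * c \<noteq> 0" "c * \<omega> + d \<noteq> 0" "c * \<alpha> + d \<noteq> 0"
  shows "hyperbolic_density \<omega> \<alpha> = ennreal \<bar>(a * d - b * c) / (c * \<omega> + d)\<^sup>2\<bar> * (ennreal \<bar>(a * d - b * c) / (c * \<alpha> + d)\<^sup>2\<bar> *
    hyperbolic_density (moebius a b c d \<omega>) (moebius a b c d \<alpha>))"
proof (cases "\<omega> = \<alpha>")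
  case False
  define e p q r where "e = a * d - b * c" and "p = c * \<omega> + d" and "q = c * \<alpha> + d" and "r = \<omega> - \<alpha>"
  have nz: "e \<noteq> 0" "p \<noteq> 0" "q \<noteq> 0" "r \<noteq> 0" using assms False by (auto simp: e_def p_def q_def r_def)
  have "1 / r\<^sup>2 = \<bar>e / p\<^sup>2\<bar> * (\<bar>e / q\<^sup>2\<bar> * (1 / (e * r / (p * q))\<^sup>2))"
    using nz by (simp add: power2_eq_square field_simps)
  then show ?thesis
    unfolding hyperbolic_density_def moebius_diff[OF assms(2,3)] e_def[symmetric] p_def[symmetric] q_def[symmetric] r_def[symmetric]
    by (simp only: ennreal_mult[symmetric] abs_ge_zero mult_nonneg_nonneg zero_le_divide_1_iff zero_le_power2)
qed (simp add: hyperbolic_density_def)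

lemma emeasure_geodesic_measure_SU11:
  assumes g: "g \<in> SU11_pm" and A: "A \<in> sets geodesic_measure"
  shows "emeasure geodesic_measure (map_prod (SU11_act g) (SU11_act g) -` A \<inter> phase_space) = emeasure geodesic_measure A"
proof -
  obtain \<alpha> \<beta> where \<alpha>\<beta>: "g = (\<alpha>, \<beta>)" by (cases g)
  define a b c d where "a = Re \<alpha> + Im \<beta>" and "b = Im \<alpha> + Re \<beta>"
    and "c = Re \<beta> - Im \<alpha>" and "d = Re \<alpha> - Im \<beta>"
  have "a * d - b * c = (cmod \<alpha>)\<^sup>2 - (cmod \<beta>)\<^sup>2"
    unfolding cmod_power2 by (simp add: a_def b_def c_def d_def power2_eq_square algebra_simps)
  then have det: "a * d - b * c \<noteq> 0" using g by (auto simp: \<alpha>\<beta> SU11_pm_def)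
  define M where "M = moebius a b c d"
  define J where "J x = ennreal \<bar>(a * d - b * c) / (c * x + d)\<^sup>2\<bar>" for x
  define G where "G x y = hyperbolic_density x y * indicator A (cayley x, cayley y)" for x y
  define A' where "A' = map_prod (SU11_act g) (SU11_act g) -` A \<inter> phase_space"
  have A' [measurable]: "A' \<in> sets geodesic_measure"
    using measurable_sets[OF map_prod_SU11_act_measurable[OF g] A] by (simp add: A'_def)
  have [measurable]: "A \<in> sets borel" using A by (simp add: mem_sets_geodesic_measure)
  have [measurable]: "(\<lambda>z. indicator A (cayley (fst z), cayley (snd z)) :: ennreal)
      \<in> borel_measurable (borel \<Otimes>\<^sub>M borel)"
  proof -
    have "(\<lambda>z::real \<times> real. (cayley (fst z), cayley (snd z))) \<in> borel_measurable (borel \<Otimes>\<^sub>M borel)"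
      by (intro borel_measurable_Pair) measurable
    then show ?thesis by measurable
  qed
  have G [measurable]: "(\<lambda>z. G (fst z) (snd z)) \<in> borel_measurable (borel \<Otimes>\<^sub>M borel)"
    unfolding G_def hyperbolic_density_def by measurable
  have [measurable]: "G x \<in> borel_measurable borel" for x
    using measurable_compose[OF measurable_Pair1' G, of x] by simp
  have [measurable]: "(\<lambda>x. \<integral>\<^sup>+y. G x y \<partial>lborel) \<in> borel_measurable borel"
    using lborel.borel_measurable_nn_integral_fst[of "\<lambda>z. G (fst z) (snd z)" borel] G by simp
  \<comment> \<open>At the pole the image corresponds to the point at infinity and the conjugation
    with a real Moebius map breaks down; a single point is a null set.\<close>
  have pole: "AE x in lborel. c * x + d \<noteq> 0"
  proof (cases "c = 0")
    case True
    then show ?thesis using det by auto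
  next
    case False
    have "AE x in lborel. x \<noteq> - d / c" by (rule AE_lborel_singleton)
    then show ?thesis
    proof (rule eventually_mono)
      fix x assume "x \<noteq> - d / c"
      then show "c * x + d \<noteq> 0" using False by (auto simp: field_simps add_eq_0_iff)
    qed
  qed
  have pt: "hyperbolic_density x y * indicator A' (cayley x, cayley y) = J x * (J y * G (M x) (M y))"
    if "c * x + d \<noteq> 0" "c * y + d \<noteq> 0" for x y
  proof (cases "x = y")
    case True
    then show ?thesis by (simp add: hyperbolic_density_def G_def)
  next
    case False
    then have "(cayley x, cayley y) \<in> phase_space"
      using cayley_circle cayley_inj by (auto simp: phase_space_def simp del: mem_sphere_0)
    then have "indicator A' (cayley x, cayley y) = (indicator A (cayley (M x), cayley (M y)) :: ennreal)"
      using that SU11_act_cayley[OF refl, of \<beta> \<alpha>]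
      by (auto simp: A'_def M_def \<alpha>\<beta> a_def b_def c_def d_def indicator_def)
    then show ?thesis
      using hyperbolic_density_moebius[OF det that]
      by (simp add: G_def J_def M_def mult.assoc)
  qed
  have "emeasure geodesic_measure A' =
    (\<integral>\<^sup>+x. \<integral>\<^sup>+y. hyperbolic_density x y * indicator A' (cayley x, cayley y) \<partial>lborel \<partial>lborel)"
    by (rule emeasure_geodesic_measure[OF A'])
  also have "\<dots> = (\<integral>\<^sup>+x. \<integral>\<^sup>+y. J x * (J y * G (M x) (M y)) \<partial>lborel \<partial>lborel)"
  proof (rule nn_integral_cong_AE, rule eventually_mono[OF pole])
    fix x assume x: "c * x + d \<noteq> 0"
    show "(\<integral>\<^sup>+y. hyperbolic_density x y * indicator A' (cayley x, cayley y) \<partial>lborel) =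
      (\<integral>\<^sup>+y. J x * (J y * G (M x) (M y)) \<partial>lborel)"
      by (intro nn_integral_cong_AE eventually_mono[OF pole] pt x)
  qed
  \<comment> \<open>The inner variable is changed first, with \<open>x\<close> fixed, and then the
    outer one.\<close>
  also have "\<dots> = (\<integral>\<^sup>+x. J x * (\<integral>\<^sup>+y. J y * G (M x) (M y) \<partial>lborel) \<partial>lborel)"
    by (intro nn_integral_cong nn_integral_cmult) (auto simp: J_def M_def)
  also have "\<dots> = (\<integral>\<^sup>+x. J x * (\<integral>\<^sup>+y. G (M x) y \<partial>lborel) \<partial>lborel)"
    unfolding J_def M_def by (intro nn_integral_cong arg_cong2[of _ _ _ _ "(*)"] refl nn_integral_moebius[OF det]) auto
  also have "\<dots> = (\<integral>\<^sup>+x. \<integral>\<^sup>+y. G x y \<partial>lborel \<partial>lborel)"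
    unfolding J_def M_def by (rule nn_integral_moebius[OF det]) measurable
  also have "\<dots> = emeasure geodesic_measure A"
    unfolding G_def by (rule emeasure_geodesic_measure[OF A, symmetric])
  finally show ?thesis by (simp only: A'_def)
qed

lemma measure_preserving_SU11:
  assumes "g \<in> SU11_pm"
  shows "measure_preserving geodesic_measure (map_prod (SU11_act g) (SU11_act g))"
  unfolding measure_preserving_def
proof (intro conjI measure_eqI)
  note T = map_prod_SU11_act_measurable[OF assms]
  show "map_prod (SU11_act g) (SU11_act g) \<in> measurable geodesic_measure geodesic_measure" by (rule T)
  fix A assume "A \<in> sets (distr geodesic_measure geodesic_measure (map_prod (SU11_act g) (SU11_act g)))"
  then have "A \<in> sets geodesic_measure" by simp
  then show "emeasure (distr geodesic_measure geodesic_measure (map_prod (SU11_act g) (SU11_act g))) A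
      = emeasure geodesic_measure A"
    using emeasure_geodesic_measure_SU11[OF assms] by (simp add: emeasure_distr[OF T])
qed simp


text \<open>Dividing the matrix of \<open>reflect\<close> by \<open>p - q\<close> gives the required
  shape: on the circle, conjugation sends \<open>(p + q) / (p - q)\<close> to its negative and
  \<open>- 2 * p * q / (p - q)\<close> to \<open>2 / (p - q)\<close>. By the parallelogram law the
  determinant is -1.\<close>

lemma reflect_SU11:
  assumes "p \<in> circle" "q \<in> circle" "p \<noteq> q"
  defines "g \<equiv> ((p + q) / (p - q), - 2 * p * q / (p - q))"
  shows "g \<in> SU11_pm" "z \<in> circle \<Longrightarrow> SU11_act g z = reflect p q z"
proof -
  have nz: "p \<noteq> 0" "q \<noteq> 0" using assms by auto
  have "(cmod (p + q))\<^sup>2 - 4 = - (cmod (p - q))\<^sup>2"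
    using dot_norm[of p q] dot_norm_neg[of p q] assms(1,2) by simp
  moreover have "(cmod (p - q))\<^sup>2 \<noteq> 0" using assms(3) by simp
  moreover have "cmod (2 * p * q) = 2" using assms(1,2) by (simp add: norm_mult)
  ultimately have "(cmod ((p + q) / (p - q)))\<^sup>2 - (cmod (- 2 * p * q / (p - q)))\<^sup>2 = - 1"
    by (simp add: norm_divide power_divide flip: diff_divide_distrib)
  then show "g \<in> SU11_pm" by (simp add: g_def SU11_pm_def)
  assume z: "z \<in> circle"
  have "cnj (- 2 * p * q / (p - q)) = 2 / (p - q)"
    using nz assms(1-3) by (simp add: cnj_circle divide_simps)
  moreover have "cnj ((p + q) / (p - q)) = - (p + q) / (p - q)"
    using nz assms(1-3) by (simp add: cnj_circle divide_simps) (simp add: algebra_simps)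
  ultimately have "SU11_act g z = ((p + q) / (p - q) * z + - 2 * p * q / (p - q)) / (2 / (p - q) * z + - (p + q) / (p - q))"
    by (simp only: SU11_act_def g_def case_prod_conv)
  also have "(p + q) / (p - q) * z + - 2 * p * q / (p - q) = ((p + q) * z - 2 * p * q) / (p - q)"
    by (simp only: times_divide_eq_left add_divide_distrib[symmetric]) simp
  also have "2 / (p - q) * z + - (p + q) / (p - q) = (2 * z - (p + q)) / (p - q)"
    by (simp only: times_divide_eq_left add_divide_distrib[symmetric]) simp
  also have "((p + q) * z - 2 * p * q) / (p - q) / ((2 * z - (p + q)) / (p - q)) = reflect p q z"
    using assms(3) by (simp add: reflect_def)
  finally show "SU11_act g z = reflect p q z" .
qed

section \<open>The billiard system and its natural extension property\<close>

lemma partition_on_fibers: "partition_on A (fibers A p)"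
  by (auto simp: partition_on_def fibers_def disjoint_def)

text \<open>Preimages of the members of a countable base are unions of fibers, and the T1 property
  lets them separate any two fibers.\<close>

lemma measurable_partition_fibers:
  fixes p :: "'a \<Rightarrow> 'b::{second_countable_topology, t1_space}"
  assumes p [measurable]: "p \<in> borel_measurable M"
  shows "measurable_partition M (fibers (space M) p)"
  unfolding measurable_partition_def
proof (intro conjI partition_on_fibers)
  obtain \<B> :: "'b set set" where \<B>: "countable \<B>" "topological_basis \<B>"
    using ex_countable_basis by blast
  have "\<B> \<noteq> {}" using topological_basisE[OF \<B>(2) open_UNIV UNIV_I] by blast
  define U where "U = from_nat_into \<B>"
  have U: "topological_basis (range U)"
    unfolding U_def range_from_nat_into[OF \<open>\<B> \<noteq> {}\<close> \<B>(1)] by (rule \<B>(2))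
  define A where "A n = p -` U n \<inter> space M" for n
  have op: "open (U n)" for n using U topological_basis_open by blast
  show "\<exists>A::nat \<Rightarrow> 'a set. (\<forall>n. A n \<in> sets M \<and> (\<exists>Q\<subseteq>fibers (space M) p. A n = \<Union>Q)) \<and>
    (\<forall>X\<in>fibers (space M) p. \<forall>Y\<in>fibers (space M) p. X \<noteq> Y \<longrightarrow>
      (\<exists>n. X \<subseteq> A n \<and> Y \<inter> A n = {} \<or> Y \<subseteq> A n \<and> X \<inter> A n = {}))"
  proof (intro exI[of _ A] conjI allI ballI impI)
    show "A n \<in> sets M" for n
      unfolding A_def using op by (intro measurable_sets[OF p]) auto
    show "\<exists>Q\<subseteq>fibers (space M) p. A n = \<Union>Q" for n
      by (intro exI[of _ "{X \<in> fibers (space M) p. X \<subseteq> A n}"]) (auto simp: fibers_def A_def)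
    fix X Y assume "X \<in> fibers (space M) p" "Y \<in> fibers (space M) p" and neq: "X \<noteq> Y"
    then obtain x y where X: "X = {z \<in> space M. p z = x}" and Y: "Y = {z \<in> space M. p z = y}"
      unfolding fibers_def by blast
    with neq have "x \<noteq> y" by blast
    then obtain V where V: "open V" "x \<in> V" "y \<notin> V" using t1_space by blast
    then obtain n where "x \<in> U n" "U n \<subseteq> V"
      using U by (auto elim!: topological_basisE)
    with X Y V show "\<exists>n. X \<subseteq> A n \<and> Y \<inter> A n = {} \<or> Y \<subseteq> A n \<and> X \<inter> A n = {}"
      by (intro exI[of _ n]) (auto simp: A_def)
  qed
qed

text \<open>A nonempty intersection of fibers consists of the points that agree with one of its
  members under every \<open>p t\<close>; separation leaves only that member.\<close>

lemma partition_sup_fibers: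
  assumes sep: "\<And>x y. x \<in> A \<Longrightarrow> y \<in> A \<Longrightarrow> (\<And>t. p t x = p t y) \<Longrightarrow> x = y"
  shows "partition_sup (\<lambda>t. fibers A (p t)) = (\<lambda>x. {x}) ` A"
proof (intro set_eqI iffI)
  fix Z assume "Z \<in> partition_sup (\<lambda>t. fibers A (p t))"
  then obtain X where X: "\<And>t. X t \<in> fibers A (p t)" "Z = (\<Inter>t. X t)" "Z \<noteq> {}"
    by (auto simp: partition_sup_def)
  then obtain z where z: "\<And>t. z \<in> X t" by auto
  have Xt: "X t = {x \<in> A. p t x = p t z}" for t
  proof -
    obtain y where "X t = {x \<in> A. p t x = y}" using X(1)[of t] by (auto simp: fibers_def)
    with z[of t] show ?thesis by auto
  qed
  then have "z \<in> A" using z[of 0] by auto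
  moreover have "Z = {z}" using X(2) Xt \<open>z \<in> A\<close> sep by auto
  ultimately show "Z \<in> (\<lambda>x. {x}) ` A" by blast
next
  fix Z assume "Z \<in> (\<lambda>x. {x}) ` A"
  then obtain z where z: "z \<in> A" "Z = {z}" by auto
  have "{z} = (\<Inter>t. {x \<in> A. p t x = p t z})" using sep z(1) by auto
  moreover have "{x \<in> A. p t x = p t z} \<in> fibers A (p t)" for t using z(1) by (auto simp: fibers_def)
  ultimately show "Z \<in> partition_sup (\<lambda>t. fibers A (p t))"
    unfolding partition_sup_def z(2) by blast
qed

lemma factor_measure_preserving:
  assumes "measure_preserving M T" "factor_via M T N S p" "S \<in> measurable N N"
  shows "measure_preserving N S"
proof -
  have T: "T \<in> measurable M M" "distr M M T = M" and p: "p \<in> measurable M N" "distr M N p = N"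
    and eq: "\<And>x. x \<in> space M \<Longrightarrow> p (T x) = S (p x)"
    using assms by (auto simp: measure_preserving_def factor_via_def)
  have "distr N N S = distr (distr M N p) N S" by (simp add: p(2))
  also have "\<dots> = distr M N (S \<circ> p)" by (rule distr_distr[OF assms(3) p(1)])
  also have "\<dots> = distr M N (p \<circ> T)" by (intro distr_cong) (auto simp: eq)
  also have "\<dots> = distr (distr M M T) N p" by (rule distr_distr[OF p(1) T(1), symmetric])
  also have "\<dots> = N" by (simp add: T(2) p(2))
  finally show ?thesis using assms(3) by (simp add: measure_preserving_def)
qed

context unimodular_billiard
begin

abbreviation "S1 \<equiv> restrict_space borel circle :: complex measure"
abbreviation "MB \<equiv> billiard_measure ts"

section \<open>Borel measurability of the factor map and of the domain\<close>

lemma borel_measurable_side_reflect [measurable]: "side_reflect ts a \<in> borel_measurable borel"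
  unfolding side_reflect_def reflect_def[abs_def] by measurable

lemma side_arc_borel:
  assumes "a < m"
  shows "side_arc ts a \<in> sets borel"
proof -
  have "open {z. 0 < lorentz (z, 1) (side_normal a)}"
    unfolding lorentz_def fst_conv snd_conv by (intro open_Collect_less continuous_intros)
  moreover have "side_arc ts a = circle \<inter> ({\<theta> a} \<union> {z. 0 < lorentz (z, 1) (side_normal a)})"
    using mem_side_arc[OF assms] by blast
  ultimately show ?thesis by (auto intro!: sets.Int sets.Un)
qed

lemma measurable_side_index [measurable]: "side_index ts \<in> measurable S1 (count_space UNIV)"
proof -
  have "side_index ts -` {a} \<inter> circle \<in> sets S1" for a
  proof (cases "a < m")
    case True
    then have "side_index ts -` {a} \<inter> circle = side_arc ts a"
      using side_index side_index_eq[OF True] mem_side_arc[OF True] by blast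
    then show ?thesis
      using side_arc_borel[OF True] mem_side_arc[OF True] by (auto simp: sets_restrict_space_iff)
  next
    case False
    then have "side_index ts -` {a} \<inter> circle = {}" using side_index(1) by blast
    then show ?thesis by simp
  qed
  then show ?thesis
    by (subst measurable_count_space_eq2_countable) (auto simp: space_restrict_space)
qed

lemma measurable_billiard_factor [measurable]: "B \<in> measurable S1 S1"
proof (rule measurable_restrict_space2)
  show "B \<in> space S1 \<rightarrow> circle" using billiard_factor_circle by (auto simp: space_restrict_space)
  show "B \<in> borel_measurable S1"
    unfolding billiard_factor_def[abs_def]
    by (rule measurable_compose_countable[OF _ measurable_side_index])
      (intro measurable_restrict_space1 borel_measurable_side_reflect)
qed

text \<open>The terminating points form a countable union of preimages of vertices under iterates of
  \<open>B\<close>.\<close>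

lemma nonterminating_borel: "{z \<in> circle. \<not> terminating ts z} \<in> sets borel"
proof -
  have B: "B ^^ h \<in> measurable S1 S1" for h
  proof (induction h)
    case (Suc h)
    then show ?case using measurable_comp[OF Suc measurable_billiard_factor] by (simp only: funpow.simps)
  qed (simp add: id_def)
  have "\<theta> a \<in> circle" for a by (rule vertex_circle)
  then have "{\<theta> a} \<in> sets S1" for a by (subst sets_restrict_space_iff) auto
  then have "(B ^^ h) -` {\<theta> a} \<inter> circle \<in> sets S1" for h a
    using measurable_sets[OF B, of "{\<theta> a}" h] by (simp add: space_restrict_space)
  then have U: "(\<Union>a<m. (B ^^ h) -` {\<theta> a} \<inter> circle) \<in> sets S1" for h
    by (intro sets.finite_UN) auto
  have "(\<Union>h. \<Union>a<m. (B ^^ h) -` {\<theta> a} \<inter> circle) \<in> sets S1"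
    by (intro sets.countable_UN'' countableI_type U)
  moreover have "circle \<in> sets S1" by (simp add: sets_restrict_space_iff)
  ultimately have "circle - (\<Union>h. \<Union>a<m. (B ^^ h) -` {\<theta> a} \<inter> circle) \<in> sets S1"
    by (rule sets.Diff[rotated])
  moreover have "circle - (\<Union>h. \<Union>a<m. (B ^^ h) -` {\<theta> a} \<inter> circle) = {z \<in> circle. \<not> terminating ts z}"
    unfolding terminating_def by blast
  ultimately show ?thesis by (simp add: sets_restrict_space_iff del: mem_sphere_0)
qed

lemma billiard_domain_sets: "D \<in> sets geodesic_measure"
proof -
  let ?N = "{z \<in> circle. \<not> terminating ts z}"
  have "D = phase_space \<inter> (?N \<times> ?N) - (\<Union>a<m. side_arc ts a \<times> side_arc ts a)"
    by (auto simp: billiard_domain_def phase_space_def)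
  also have "\<dots> \<in> sets borel"
    using nonterminating_borel side_arc_borel
    by (intro sets.Diff sets.Int sets.finite_UN borel_Times phase_space_borel) auto
  finally show ?thesis by (auto simp: mem_sets_geodesic_measure billiard_domain_def)
qed

lemma space_billiard_measure [simp]: "space MB = D"
  using sets.sets_into_space[OF billiard_domain_sets]
  by (auto simp: billiard_measure_def space_restrict_space)

lemma mem_sets_billiard_measure: "A \<in> sets MB \<longleftrightarrow> A \<in> sets borel \<and> A \<subseteq> D"
proof -
  have "D \<subseteq> phase_space" by (auto simp: billiard_domain_def)
  moreover from this have "D \<inter> space geodesic_measure \<in> sets geodesic_measure"
    using billiard_domain_sets by (simp add: Int_absorb2)
  from sets_restrict_space_iff[OF this] have "A \<in> sets MB \<longleftrightarrow> A \<subseteq> D \<and> A \<in> sets geodesic_measure"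
    by (simp only: billiard_measure_def)
  ultimately show ?thesis by (auto simp: mem_sets_geodesic_measure)
qed

lemma sets_billiard_measure: "sets MB = sets (restrict_space borel D)"
  using billiard_domain_sets
  by (auto simp: mem_sets_billiard_measure sets_restrict_space_iff mem_sets_geodesic_measure)

lemma emeasure_billiard_measure: "A \<in> sets MB \<Longrightarrow> emeasure MB A = emeasure geodesic_measure A"
  using billiard_domain_sets sets.sets_into_space[OF billiard_domain_sets]
  unfolding mem_sets_billiard_measure unfolding billiard_measure_def
  by (intro emeasure_restrict_space) (auto simp: Int_absorb2)

section \<open>Measurability and invariance on the domain\<close>

lemma measurable_billiard_measureI:
  assumes "f \<in> borel_measurable MB" "\<And>x. x \<in> D \<Longrightarrow> f x \<in> D"
  shows "f \<in> measurable MB MB"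
proof -
  have "f \<in> measurable MB (restrict_space borel D)"
    using assms by (intro measurable_restrict_space2) auto
  then show ?thesis by (simp only: measurable_cong_sets[OF refl sets_billiard_measure])
qed

lemma borel_measurable_billiard_measure: "f \<in> borel_measurable borel \<Longrightarrow> f \<in> borel_measurable MB"
  by (simp only: measurable_cong_sets[OF sets_billiard_measure refl] measurable_restrict_space1)

lemma measurable_fst_billiard [measurable]: "fst \<in> measurable MB S1"
  by (intro measurable_restrict_space2 borel_measurable_billiard_measure measurable_fst_snd_complex)
    (auto simp: mem_billiard_domain)

lemma measurable_billiard: "T \<in> measurable MB MB"
proof (rule measurable_billiard_measureI)
  have "(\<lambda>x. (\<lambda>a x. (side_reflect ts a (fst x), side_reflect ts a (snd x))) (side_index ts (fst x)) x)
    \<in> borel_measurable MB"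
    by (rule measurable_compose_countable[OF _ measurable_compose[OF measurable_fst_billiard measurable_side_index]])
      (intro borel_measurable_billiard_measure borel_measurable_Pair; measurable)
  then show "T \<in> borel_measurable MB" by (simp add: billiard_def case_prod_beta')
qed (rule billiard_mem)

lemma measurable_billiard_inv: "billiard_inv \<in> measurable MB MB"
proof -
  have "(\<lambda>x. (snd x, fst x)) \<in> borel_measurable (borel :: (complex \<times> complex) measure)"
    by (intro borel_measurable_Pair) measurable
  then have "prod.swap \<in> borel_measurable (borel :: (complex \<times> complex) measure)"
    by (simp add: prod.swap_def [abs_def])
  then have swap: "prod.swap \<in> measurable MB MB"
    using swap_mem_billiard_domain by (intro measurable_billiard_measureI borel_measurable_billiard_measure) auto
  show ?thesis
    using measurable_comp[OF measurable_comp[OF swap measurable_billiard] swap]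
    by (simp only: billiard_inv_def comp_assoc)
qed

text \<open>Reduces invariance under \<open>T\<close> to invariance under the group. The branch with
  first coordinate in the arc \<open>a\<close> acts as \<open>g\<close>, and its image consists of
  the points of the domain with second coordinate in that arc; restricting the target thus already
  forces the source into the branch.\<close>

lemma billiard_branch_preimage:
  assumes a: "a < m" and A: "A \<subseteq> D"
  obtains g where "g \<in> SU11_pm"
    "{x \<in> D. side_index ts (fst x) = a \<and> T x \<in> A}
      = map_prod (SU11_act g) (SU11_act g) -` {y \<in> A. side_index ts (snd y) = a} \<inter> phase_space"
proof -
  define g where "g = ((\<theta> a + \<theta> (Suc a)) / (\<theta> a - \<theta> (Suc a)), - 2 * \<theta> a * \<theta> (Suc a) / (\<theta> a - \<theta> (Suc a)))"
  have g: "g \<in> SU11_pm" and act: "\<And>z. z \<in> circle \<Longrightarrow> SU11_act g z = side_reflect ts a z"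
    unfolding g_def side_reflect_def
    using reflect_SU11[OF vertex_circle vertex_circle vertex_neq_Suc[OF a]] by auto
  have key: "(\<sigma>, \<rho>) \<in> D \<and> side_index ts \<sigma> = a \<and> T (\<sigma>, \<rho>) \<in> A \<longleftrightarrow>
    (SU11_act g \<sigma>, SU11_act g \<rho>) \<in> A \<and> side_index ts (SU11_act g \<rho>) = a \<and> (\<sigma>, \<rho>) \<in> phase_space" for \<sigma> \<rho>
  proof (intro iffI conjI; (elim conjE)?)
    assume *: "(\<sigma>, \<rho>) \<in> D" "side_index ts \<sigma> = a" "T (\<sigma>, \<rho>) \<in> A"
    then have c: "\<sigma> \<in> circle" "\<rho> \<in> circle" by (auto simp only: mem_billiard_domain)
    show "(\<sigma>, \<rho>) \<in> phase_space" using * by (auto simp: billiard_domain_def)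
    show "(SU11_act g \<sigma>, SU11_act g \<rho>) \<in> A" using * by (simp add: billiard_def act[OF c(1)] act[OF c(2)])
    show "side_index ts (SU11_act g \<rho>) = a" using billiard_step(3)[OF *(1)] * by (simp add: act[OF c(1)] act[OF c(2)])
  next
    assume *: "(SU11_act g \<sigma>, SU11_act g \<rho>) \<in> A" "side_index ts (SU11_act g \<rho>) = a" "(\<sigma>, \<rho>) \<in> phase_space"
    then have c: "\<sigma> \<in> circle" "\<rho> \<in> circle" by (auto simp: phase_space_def)
    have y: "(side_reflect ts a \<sigma>, side_reflect ts a \<rho>) \<in> D" using * A by (auto simp: act[OF c(1)] act[OF c(2)])
    have i: "side_index ts (side_reflect ts a \<rho>) = a" using * by (simp add: act[OF c(1)] act[OF c(2)])
    \<comment> \<open>Identifies the given pair as \<open>billiard_inv\<close> of a point of the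
      domain, from which its membership and the side of \<open>\<sigma>\<close> follow.\<close>
    have "billiard_inv (side_reflect ts a \<sigma>, side_reflect ts a \<rho>) = (\<sigma>, \<rho>)"
      by (simp add: billiard_inv_def billiard_def i side_reflect_involution[OF a c(1)] side_reflect_involution[OF a c(2)])
    from billiard_inv_mem[OF y] snd_billiard_inv(2)[OF y] billiard_billiard_inv[OF y]
    show "(\<sigma>, \<rho>) \<in> D" "side_index ts \<sigma> = a" "T (\<sigma>, \<rho>) \<in> A"
      using * unfolding \<open>billiard_inv _ = _\<close> by (simp_all add: i act[OF c(1)] act[OF c(2)])
  qed
  show ?thesis
  proof (rule that[OF g], rule set_eqI)
    fix x :: "complex \<times> complex"
    obtain \<sigma> \<rho> where x: "x = (\<sigma>, \<rho>)" by (cases x)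
    show "x \<in> {x \<in> D. side_index ts (fst x) = a \<and> T x \<in> A} \<longleftrightarrow>
      x \<in> map_prod (SU11_act g) (SU11_act g) -` {y \<in> A. side_index ts (snd y) = a} \<inter> phase_space"
      using key[of \<sigma> \<rho>] by (simp add: x)
  qed
qed

lemma measure_preserving_billiard: "measure_preserving MB T"
  unfolding measure_preserving_def
proof (intro conjI measure_eqI measurable_billiard)
  fix A assume "A \<in> sets (distr MB MB T)"
  then have A: "A \<in> sets MB" by simp
  \<comment> \<open>The preimage of \<open>A\<close> is cut by the side of the first coordinate,
    \<open>A\<close> itself by the side of the second; \<open>T\<close> matches the pieces.\<close>
  define E where "E a = {x \<in> D. side_index ts (fst x) = a \<and> T x \<in> A}" for a
  define F where "F a = {y \<in> A. side_index ts (snd y) = a}" for a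
  have AD: "A \<subseteq> D" "A \<in> sets borel" using A by (auto simp: mem_sets_billiard_measure)
  have circ: "fst x \<in> circle" "snd x \<in> circle" if "x \<in> D" for x
    using that by (cases x; simp only: mem_billiard_domain fst_conv snd_conv)+
  have DP: "D \<subseteq> phase_space" by (auto simp: billiard_domain_def)
  have F: "F a \<in> sets geodesic_measure" if "a < m" for a
  proof -
    have "F a = A \<inter> (UNIV \<times> side_arc ts a)"
    proof (intro set_eqI iffI)
      fix x assume "x \<in> F a"
      then show "x \<in> A \<inter> (UNIV \<times> side_arc ts a)"
        using side_index(2)[OF circ(2), of x] AD(1) by (auto simp: F_def mem_Times_iff)
    next
      fix x assume "x \<in> A \<inter> (UNIV \<times> side_arc ts a)"
      then show "x \<in> F a" using side_index_eq[OF that, of "snd x"] by (auto simp: F_def)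
    qed
    also have "\<dots> \<in> sets borel"
      using AD side_arc_borel[OF that] by (intro sets.Int borel_Times) auto
    finally show ?thesis using AD DP by (auto simp: mem_sets_geodesic_measure F_def)
  qed
  have E: "E a \<in> sets geodesic_measure" "emeasure geodesic_measure (E a) = emeasure geodesic_measure (F a)"
    if a: "a < m" for a
  proof -
    obtain g where g: "g \<in> SU11_pm"
      "E a = map_prod (SU11_act g) (SU11_act g) -` F a \<inter> phase_space"
      using billiard_branch_preimage[OF a AD(1)] unfolding E_def F_def by blast
    show "E a \<in> sets geodesic_measure"
      using measurable_sets[OF map_prod_SU11_act_measurable[OF g(1)] F[OF a]] by (simp add: g(2))
    show "emeasure geodesic_measure (E a) = emeasure geodesic_measure (F a)"
      unfolding g(2) by (rule emeasure_geodesic_measure_SU11[OF g(1) F[OF a]])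
  qed
  have UE: "T -` A \<inter> D = (\<Union>a<m. E a)"
    using side_index(1)[OF circ(1)] unfolding E_def by blast
  have UF: "A = (\<Union>a<m. F a)"
    using side_index(1)[OF circ(2)] AD(1) unfolding F_def by blast
  have "emeasure (distr MB MB T) A = emeasure MB (T -` A \<inter> D)"
    using A by (simp add: emeasure_distr[OF measurable_billiard])
  also have "\<dots> = emeasure geodesic_measure (T -` A \<inter> D)"
    using measurable_sets[OF measurable_billiard A] by (intro emeasure_billiard_measure) simp
  also have "\<dots> = (\<Sum>a<m. emeasure geodesic_measure (E a))"
    unfolding UE using E by (intro sum_emeasure[symmetric]) (auto simp: disjoint_family_on_def E_def)
  also have "\<dots> = (\<Sum>a<m. emeasure geodesic_measure (F a))"
    using E by (intro sum.cong) auto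
  also have "\<dots> = emeasure geodesic_measure (\<Union>a<m. F a)"
    using F by (intro sum_emeasure) (auto simp: disjoint_family_on_def F_def)
  also have "\<dots> = emeasure MB A"
    using A by (simp add: UF[symmetric] emeasure_billiard_measure)
  finally show "emeasure (distr MB MB T) A = emeasure MB A" .
qed simp

section \<open>The factor system and the natural extension\<close>

lemma factor_via_fst: "factor_via MB T (factor_measure ts) B fst"
proof -
  have "fst \<in> measurable MB (factor_measure ts)" by (simp add: factor_measure_def)
  moreover have "distr MB (factor_measure ts) fst = factor_measure ts"
    unfolding factor_measure_def by (intro distr_cong) auto
  moreover have "fst (T x) = B (fst x)" for x by (cases x) (simp add: billiard_Pair)
  ultimately show ?thesis by (simp add: factor_via_def)
qed

lemma measure_preserving_billiard_factor: "measure_preserving (factor_measure ts) B"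
  by (rule factor_measure_preserving[OF measure_preserving_billiard factor_via_fst])
    (simp add: factor_measure_def measurable_billiard_factor)

lemma invertible_system_billiard: "invertible_system MB T"
proof -
  have "the_inv_into D T x = billiard_inv x" if "x \<in> D" for x
    using that bij_betw_billiard
    by (intro the_inv_into_f_eq) (auto simp: bij_betw_def billiard_billiard_inv billiard_inv_mem)
  then have "the_inv_into D T \<in> measurable MB MB"
    using measurable_billiard_inv by (subst measurable_cong[of _ _ billiard_inv]) auto
  then show ?thesis
    using measure_preserving_billiard bij_betw_billiard by (simp add: invertible_system_def)
qed

lemma billiard_orbit_inverse:
  assumes "x \<in> D"
  shows "(T ^^ t) x \<in> D" "(billiard_inv ^^ t) ((T ^^ t) x) = x" "(T ^^ t) ((billiard_inv ^^ t) x) = x"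
proof -
  have *: "(T ^^ t) x \<in> D" for t using assms by (induction t) (auto simp: billiard_mem)
  then show "(T ^^ t) x \<in> D" .
  show "(billiard_inv ^^ t) ((T ^^ t) x) = x"
  proof (induction t)
    case (Suc t)
    have "(billiard_inv ^^ Suc t) ((T ^^ Suc t) x) = (billiard_inv ^^ t) (billiard_inv (T ((T ^^ t) x)))"
      by (simp add: funpow_swap1)
    then show ?case using Suc billiard_inv_billiard[OF *] by simp
  qed simp
  show "(T ^^ t) ((billiard_inv ^^ t) x) = x"
  proof (induction t)
    case (Suc t)
    have "(T ^^ Suc t) ((billiard_inv ^^ Suc t) x) = (T ^^ t) (T (billiard_inv ((billiard_inv ^^ t) x)))"
      by (simp add: funpow_swap1)
    then show ?case using Suc billiard_billiard_inv[OF billiard_inv_orbit[OF assms]] by simp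
  qed simp
qed

text \<open>Pushing fibers forward by \<open>T ^^ t\<close> amounts to composing \<open>fst\<close>
  with the inverse: the partition at time \<open>t\<close> records the first coordinate
  \<open>t\<close> steps earlier.\<close>

lemma image_fibers_billiard:
  "image_fibers MB T fst t = fibers D (\<lambda>x. fst ((billiard_inv ^^ t) x))"
proof -
  have "(T ^^ t) ` {x \<in> D. fst x = y} = {x \<in> D. fst ((billiard_inv ^^ t) x) = y}" for y
  proof (intro set_eqI iffI)
    fix x assume "x \<in> {x \<in> D. fst ((billiard_inv ^^ t) x) = y}"
    then show "x \<in> (T ^^ t) ` {x \<in> D. fst x = y}"
      using billiard_orbit_inverse(3)[of x t] billiard_inv_orbit[of x t]
      by (intro image_eqI[of _ _ "(billiard_inv ^^ t) x"]) auto
  qed (auto simp: billiard_orbit_inverse)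
  \<comment> \<open>As \<open>T ^^ t\<close> permutes the domain, both maps take the same values
    there, so the two families of fibers have the same index set.\<close>
  moreover have "fst ` D = (\<lambda>x. fst ((billiard_inv ^^ t) x)) ` D"
  proof (intro set_eqI iffI)
    fix y assume "y \<in> fst ` D"
    then obtain x where "x \<in> D" "y = fst x" by blast
    then show "y \<in> (\<lambda>x. fst ((billiard_inv ^^ t) x)) ` D"
      by (intro image_eqI[of _ _ "(T ^^ t) x"]) (auto simp: billiard_orbit_inverse)
  qed (use billiard_inv_orbit in auto)
  ultimately show ?thesis by (simp add: image_fibers_def fibers_def image_image)
qed

lemma natural_extension_billiard: "natural_extension MB T (factor_measure ts) B fst"
  unfolding natural_extension_def
proof (intro conjI allI invertible_system_billiard measure_preserving_billiard_factor factor_via_fst)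
  fix t
  have "billiard_inv ^^ t \<in> measurable MB MB"
  proof (induction t)
    case (Suc t)
    then show ?case using measurable_comp[OF Suc measurable_billiard_inv] by (simp only: funpow.simps)
  qed (simp add: id_def)
  then have "(\<lambda>x. fst ((billiard_inv ^^ t) x)) \<in> borel_measurable MB"
    by (rule measurable_compose)
      (intro borel_measurable_billiard_measure measurable_fst_snd_complex)
  from measurable_partition_fibers[OF this]
  show "measurable_partition MB (image_fibers MB T fst t)" by (simp add: image_fibers_billiard)
next
  have "partition_sup (image_fibers MB T fst) = (\<lambda>x. {x}) ` D"
    unfolding image_fibers_billiard[abs_def] by (rule partition_sup_fibers) (rule fst_past_determines)
  \<comment> \<open>The partitions agree exactly, so the empty set serves as the null set.\<close>
  then show "partition_eq_mod_null MB (partition_sup (image_fibers MB T fst)) ((\<lambda>x. {x}) ` space MB)"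
    unfolding partition_eq_mod_null_def by (intro bexI[of _ "{}"]) auto
qed

end

theorem theorem7p1:
  fixes ts :: "(int^3) list"
  assumes "unimodular_partition ts"
  shows
    "bij_betw (billiard ts) (billiard_domain ts) (billiard_domain ts)
     \<and>
     (\<forall>\<sigma> \<rho>. (\<sigma>, \<rho>) \<in> phase_space \<and> \<not> terminating ts \<sigma> \<and> \<not> terminating ts \<rho> \<longrightarrow>
        (\<exists>t. (billiard ts ^^ t) (\<sigma>, \<rho>) \<in> billiard_domain ts))
     \<and>
     ((\<forall>g\<in>SU11_pm. measure_preserving geodesic_measure (map_prod (SU11_act g) (SU11_act g))) \<and>
      measure_preserving (billiard_measure ts) (billiard ts) \<and>
      factor_via (billiard_measure ts) (billiard ts) (factor_measure ts) (billiard_factor ts) fst \<and>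
      measure_preserving (factor_measure ts) (billiard_factor ts))
     \<and>
     natural_extension (billiard_measure ts) (billiard ts)
       (factor_measure ts) (billiard_factor ts) fst"
proof -
  interpret unimodular_billiard ts by unfold_locales (rule assms)
  show ?thesis
    using bij_betw_billiard billiard_eventually_mem measure_preserving_SU11 measure_preserving_billiard
      factor_via_fst measure_preserving_billiard_factor natural_extension_billiard by blast
qed

end
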